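(* There is an equivalence of categories $$\mathcal{C}_{\mathcal{D}}\colon \mathcal{K}\ell_{\mathbb{N}}(\mathcal{D})\ \xrightarrow{\ \simeq\ }\ (\mathbf{FdCCstar}_{\mathrm{PU}})^{\mathrm{op}}$$ given on objects by $\mathcal{C}_{\mathcal{D}}(n)=\mathbb{C}^n$ and on a morphism $f\colon n\to\mathcal{D}(m)$ by the map $\mathcal{C}_{\mathcal{D}}(f)\colon\mathbb{C}^m\to\mathbb{C}^n$, $$\mathcal{C}_{\mathcal{D}}(f)(v)(i)=\sum_{j\in m} f(i)(j)\cdot v(j)\qquad (v\in\mathbb{C}^m,\ i\in n).$$
   Context: All $C^*$-algebras are unital over $\mathbb{C}$ (the zero algebra is allowed). An element is positive if it is of the form $y^*y$; a PU-map is a linear map preserving positive elements and the unit. $\mathbf{FdCCstar}_{\mathrm{PU}}$ is the category of finite-dimensional commutative $C^*$-algebras with PU-maps. $\mathbb{C}^n$ is a commutative $C^*$-algebra with pointwise operations and supremum norm. The distribution monad $\mathcal{D}$ on $\mathbf{Sets}$: $\mathcal{D}(X)$ is the set of functions $\varphi\colon X\to[0,1]$ with finite support and $\sum_x\varphi(x)=1$; on functions $f\colon X\to Y$ it acts by $\mathcal{D}(f)(\varphi)(y)=\sum_{x\in f^{-1}(y)}\varphi(x)$; the unit sends $x$ to the Dirac distribution at $x$; the multiplication is $\mu(\Phi)(x)=\sum_{\varphi}\Phi(\varphi)\cdot\varphi(x)$. $\mathcal{K}\ell_{\mathbb{N}}(\mathcal{D})$ is the full subcategory of the Kleisli category of $\mathcal{D}$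 whose objects are the natural numbers $n$, regarded as the $n$-element sets $\{0,\dots,n-1\}$; so morphisms $n\to m$ are functions $n\to\mathcal{D}(m)$, with composition $g\odot f=\mu\circ\mathcal{D}(g)\circ f$ and identities given by the unit. *)

theory Defs
  imports "Jordan_Normal_Form.VS_Connect"
begin

section \<open>Categories\<close>

text \<open>
  Hom-sets are indexed by source and target and need not be disjoint; this is why composition
  and the arrow part of a functor take the objects involved as arguments.
  \<open>Comp C X Y Z g f\<close> is the composite of \<open>f : X \<rightarrow> Y\<close> followed by \<open>g : Y \<rightarrow> Z\<close>.
\<close>

record ('o, 'm) cat =
  Ob :: "'o set"
  Hom :: "'o \<Rightarrow> 'o \<Rightarrow> 'm set"
  Ident :: "'o \<Rightarrow> 'm"
  Comp :: "'o \<Rightarrow> 'o \<Rightarrow> 'o \<Rightarrow> 'm \<Rightarrow> 'm \<Rightarrow> 'm"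

locale category =
  fixes C :: "('o, 'm) cat"
  assumes ident_in_Hom: "X \<in> Ob C \<Longrightarrow> Ident C X \<in> Hom C X X"
    and comp_in_Hom:
      "\<lbrakk>X \<in> Ob C; Y \<in> Ob C; Z \<in> Ob C; f \<in> Hom C X Y; g \<in> Hom C Y Z\<rbrakk>
        \<Longrightarrow> Comp C X Y Z g f \<in> Hom C X Z"
    and comp_ident_right:
      "\<lbrakk>X \<in> Ob C; Y \<in> Ob C; f \<in> Hom C X Y\<rbrakk> \<Longrightarrow> Comp C X X Y f (Ident C X) = f"
    and comp_ident_left:
      "\<lbrakk>X \<in> Ob C; Y \<in> Ob C; f \<in> Hom C X Y\<rbrakk> \<Longrightarrow> Comp C X Y Y (Ident C Y) f = f"
    and comp_assoc:
      "\<lbrakk>W \<in> Ob C; X \<in> Ob C; Y \<in> Ob C; Z \<in> Ob C;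
        f \<in> Hom C W X; g \<in> Hom C X Y; h \<in> Hom C Y Z\<rbrakk>
        \<Longrightarrow> Comp C W X Z (Comp C X Y Z h g) f = Comp C W Y Z h (Comp C W X Y g f)"

definition op_cat :: "('o, 'm) cat \<Rightarrow> ('o, 'm) cat" where
  "op_cat C = \<lparr>Ob = Ob C, Hom = (\<lambda>X Y. Hom C Y X), Ident = Ident C,
     Comp = (\<lambda>X Y Z g f. Comp C Z Y X f g)\<rparr>"

locale cat_functor = dom: category C + cod: category D
  for C :: "('o, 'm) cat" and D :: "('p, 'n) cat" +
  fixes Fo :: "'o \<Rightarrow> 'p" and Fm :: "'o \<Rightarrow> 'o \<Rightarrow> 'm \<Rightarrow> 'n"
  assumes map_Ob: "X \<in> Ob C \<Longrightarrow> Fo X \<in> Ob D"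
    and map_Hom: "\<lbrakk>X \<in> Ob C; Y \<in> Ob C; f \<in> Hom C X Y\<rbrakk> \<Longrightarrow> Fm X Y f \<in> Hom D (Fo X) (Fo Y)"
    and map_ident: "X \<in> Ob C \<Longrightarrow> Fm X X (Ident C X) = Ident D (Fo X)"
    and map_comp:
      "\<lbrakk>X \<in> Ob C; Y \<in> Ob C; Z \<in> Ob C; f \<in> Hom C X Y; g \<in> Hom C Y Z\<rbrakk>
        \<Longrightarrow> Fm X Z (Comp C X Y Z g f) = Comp D (Fo X) (Fo Y) (Fo Z) (Fm Y Z g) (Fm X Y f)"

definition is_iso :: "('o, 'm) cat \<Rightarrow> 'o \<Rightarrow> 'o \<Rightarrow> 'm \<Rightarrow> bool" where
  "is_iso C X Y f \<longleftrightarrow> f \<in> Hom C X Y \<and>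
     (\<exists>g\<in>Hom C Y X. Comp C X Y X g f = Ident C X \<and> Comp C Y X Y f g = Ident C Y)"

locale natural_iso = F: cat_functor C D Fo Fm + G: cat_functor C D Go Gm
  for C :: "('o, 'm) cat" and D :: "('p, 'n) cat" and Fo Fm Go Gm +
  fixes \<alpha> :: "'o \<Rightarrow> 'n"
  assumes component_iso: "X \<in> Ob C \<Longrightarrow> is_iso D (Fo X) (Go X) (\<alpha> X)"
    and natural:
      "\<lbrakk>X \<in> Ob C; Y \<in> Ob C; f \<in> Hom C X Y\<rbrakk>
        \<Longrightarrow> Comp D (Fo X) (Fo Y) (Go Y) (\<alpha> Y) (Fm X Y f)
          = Comp D (Fo X) (Go X) (Go Y) (Gm X Y f) (\<alpha> X)"

definition is_equivalence ::
  "('o, 'm) cat \<Rightarrow> ('p, 'n) cat \<Rightarrow> ('o \<Rightarrow> 'p) \<Rightarrow> ('o \<Rightarrow> 'o \<Rightarrow> 'm \<Rightarrow> 'n) \<Rightarrow> bool" where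
  "is_equivalence C D Fo Fm \<longleftrightarrow>
     cat_functor C D Fo Fm \<and>
     (\<exists>Go Gm. cat_functor D C Go Gm \<and>
       (\<exists>\<eta>. natural_iso C C (\<lambda>X. X) (\<lambda>X Y f. f)
               (\<lambda>X. Go (Fo X)) (\<lambda>X Y f. Gm (Fo X) (Fo Y) (Fm X Y f)) \<eta>) \<and>
       (\<exists>\<epsilon>. natural_iso D D (\<lambda>A. Fo (Go A)) (\<lambda>A B h. Fm (Go A) (Go B) (Gm A B h))
               (\<lambda>A. A) (\<lambda>A B h. h) \<epsilon>))"


section \<open>The distribution monad and its Kleisli category on the natural numbers\<close>

text \<open>
  A function with domain \<open>X\<close> is an extensional HOL function, so that equality of functions on
  \<open>X\<close> is HOL equality.
\<close>

definition Dist :: "'a set \<Rightarrow> ('a \<Rightarrow> real) set" where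
  "Dist X = {\<phi> \<in> X \<rightarrow>\<^sub>E {0..1}. finite {x \<in> X. \<phi> x \<noteq> 0} \<and> (\<Sum>x\<in>{x \<in> X. \<phi> x \<noteq> 0}. \<phi> x) = 1}"

definition Dist_map :: "'a set \<Rightarrow> 'b set \<Rightarrow> ('a \<Rightarrow> 'b) \<Rightarrow> ('a \<Rightarrow> real) \<Rightarrow> 'b \<Rightarrow> real" where
  "Dist_map X Y f \<phi> = (\<lambda>y\<in>Y. \<Sum>x\<in>{x \<in> X. f x = y \<and> \<phi> x \<noteq> 0}. \<phi> x)"

definition Dist_unit :: "'a set \<Rightarrow> 'a \<Rightarrow> 'a \<Rightarrow> real" where
  "Dist_unit X x = (\<lambda>y\<in>X. if y = x then 1 else 0)"

definition Dist_mult :: "'a set \<Rightarrow> (('a \<Rightarrow> real) \<Rightarrow> real) \<Rightarrow> 'a \<Rightarrow> real" where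
  "Dist_mult X \<Phi> = (\<lambda>x\<in>X. \<Sum>\<phi>\<in>{\<phi> \<in> Dist X. \<Phi> \<phi> \<noteq> 0}. \<Phi> \<phi> * \<phi> x)"

definition KlN :: "(nat, nat \<Rightarrow> nat \<Rightarrow> real) cat" where
  "KlN = \<lparr>Ob = UNIV,
     Hom = (\<lambda>n m. {..<n} \<rightarrow>\<^sub>E Dist {..<m}),
     Ident = (\<lambda>n. \<lambda>i\<in>{..<n}. Dist_unit {..<n} i),
     Comp = (\<lambda>n m k g f. \<lambda>i\<in>{..<n}.
       Dist_mult {..<k} (Dist_map {..<m} (Dist {..<k}) g (f i)))\<rparr>"


section \<open>Finite-dimensional commutative C*-algebras and positive unital maps\<close>

record 'a cstar = "(complex, 'a) module" +
  star :: "'a \<Rightarrow> 'a"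
  nrm :: "'a \<Rightarrow> real"

text \<open>
  The library locale \<^locale>\<open>algebra\<close> means commutative unital algebra; \<^term>\<open>\<one>\<^bsub>A\<^esub> = \<zero>\<^bsub>A\<^esub>\<close>
  is not excluded.
\<close>

locale comm_cstar_algebra = algebra "class_ring :: complex ring" A for A :: "'a cstar" +
  assumes star_closed: "x \<in> carrier A \<Longrightarrow> star A x \<in> carrier A"
    and star_star: "x \<in> carrier A \<Longrightarrow> star A (star A x) = x"
    and star_add:
      "\<lbrakk>x \<in> carrier A; y \<in> carrier A\<rbrakk> \<Longrightarrow> star A (x \<oplus>\<^bsub>A\<^esub> y) = star A x \<oplus>\<^bsub>A\<^esub> star A y"
    and star_smult: "x \<in> carrier A \<Longrightarrow> star A (c \<odot>\<^bsub>A\<^esub> x) = cnj c \<odot>\<^bsub>A\<^esub> star A x"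
    and star_mult:
      "\<lbrakk>x \<in> carrier A; y \<in> carrier A\<rbrakk> \<Longrightarrow> star A (x \<otimes>\<^bsub>A\<^esub> y) = star A y \<otimes>\<^bsub>A\<^esub> star A x"
    and nrm_nonneg: "x \<in> carrier A \<Longrightarrow> 0 \<le> nrm A x"
    and nrm_eq_zero_iff: "x \<in> carrier A \<Longrightarrow> nrm A x = 0 \<longleftrightarrow> x = \<zero>\<^bsub>A\<^esub>"
    and nrm_triangle:
      "\<lbrakk>x \<in> carrier A; y \<in> carrier A\<rbrakk> \<Longrightarrow> nrm A (x \<oplus>\<^bsub>A\<^esub> y) \<le> nrm A x + nrm A y"
    and nrm_smult: "x \<in> carrier A \<Longrightarrow> nrm A (c \<odot>\<^bsub>A\<^esub> x) = cmod c * nrm A x"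
    and nrm_mult:
      "\<lbrakk>x \<in> carrier A; y \<in> carrier A\<rbrakk> \<Longrightarrow> nrm A (x \<otimes>\<^bsub>A\<^esub> y) \<le> nrm A x * nrm A y"
    and nrm_star_mult: "x \<in> carrier A \<Longrightarrow> nrm A (star A x \<otimes>\<^bsub>A\<^esub> x) = (nrm A x)\<^sup>2"
    and nrm_complete:
      "\<lbrakk>\<And>k. s k \<in> carrier A;
        \<And>e. e > 0 \<Longrightarrow> \<exists>N. \<forall>k\<ge>N. \<forall>l\<ge>N. nrm A (s k \<ominus>\<^bsub>A\<^esub> s l) < e\<rbrakk>
        \<Longrightarrow> \<exists>x\<in>carrier A. (\<lambda>k. nrm A (s k \<ominus>\<^bsub>A\<^esub> x)) \<longlonglongrightarrow> 0"

definition cstar_positive :: "'a cstar \<Rightarrow> 'a \<Rightarrow> bool" where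
  "cstar_positive A x \<longleftrightarrow> (\<exists>y\<in>carrier A. x = star A y \<otimes>\<^bsub>A\<^esub> y)"

definition pu_map :: "'a cstar \<Rightarrow> 'b cstar \<Rightarrow> ('a \<Rightarrow> 'b) \<Rightarrow> bool" where
  "pu_map A B f \<longleftrightarrow>
     f \<in> LinearCombinations.module_hom (class_ring :: complex ring) A B \<and>
     (\<forall>x\<in>carrier A. cstar_positive A x \<longrightarrow> cstar_positive B (f x)) \<and>
     f \<one>\<^bsub>A\<^esub> = \<one>\<^bsub>B\<^esub>"

text \<open>
  The type \<open>'u\<close> plays the role of a universe: the objects are all structures whose carrier is
  a subset of \<open>'u\<close>.
\<close>

definition FdCCstar_PU :: "('u cstar, 'u \<Rightarrow> 'u) cat" where
  "FdCCstar_PU = \<lparr>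
     Ob = {A. comm_cstar_algebra A \<and> vectorspace.fin_dim (class_ring :: complex ring) A},
     Hom = (\<lambda>A B. {f \<in> extensional (carrier A). pu_map A B f}),
     Ident = (\<lambda>A. \<lambda>x\<in>carrier A. x),
     Comp = (\<lambda>A B C g f. compose (carrier A) g f)\<rparr>"

text \<open>The \<^term>\<open>insert 0\<close> gives the zero algebra \<open>\<complex>\<^sup>0\<close> its norm.\<close>

definition Cn :: "nat \<Rightarrow> (nat \<Rightarrow> complex) cstar" where
  "Cn n = \<lparr>
     carrier = {..<n} \<rightarrow>\<^sub>E UNIV,
     monoid.mult = (\<lambda>v w. \<lambda>i\<in>{..<n}. v i * w i),
     one = (\<lambda>i\<in>{..<n}. 1),
     zero = (\<lambda>i\<in>{..<n}. 0),
     add = (\<lambda>v w. \<lambda>i\<in>{..<n}. v i + w i),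
     smult = (\<lambda>c v. \<lambda>i\<in>{..<n}. c * v i),
     star = (\<lambda>v. \<lambda>i\<in>{..<n}. cnj (v i)),
     nrm = (\<lambda>v. Max (insert 0 ((\<lambda>i. cmod (v i)) ` {..<n})))\<rparr>"

text \<open>
  Transport of structure along an injection \<open>\<iota>\<close>: it turns \<open>\<complex>\<^sup>n\<close> into an object of
  the category over any universe \<open>'u\<close> that is large enough to contain it. For \<open>\<iota> = id\<close>
  nothing happens.
\<close>

definition transport :: "('a \<Rightarrow> 'u) \<Rightarrow> 'a cstar \<Rightarrow> 'u cstar" where
  "transport \<iota> A = \<lparr>
     carrier = \<iota> ` carrier A,
     monoid.mult = (\<lambda>x y. \<iota> (inv_into UNIV \<iota> x \<otimes>\<^bsub>A\<^esub> inv_into UNIV \<iota> y)),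
     one = \<iota> \<one>\<^bsub>A\<^esub>,
     zero = \<iota> \<zero>\<^bsub>A\<^esub>,
     add = (\<lambda>x y. \<iota> (inv_into UNIV \<iota> x \<oplus>\<^bsub>A\<^esub> inv_into UNIV \<iota> y)),
     smult = (\<lambda>c x. \<iota> (c \<odot>\<^bsub>A\<^esub> inv_into UNIV \<iota> x)),
     star = (\<lambda>x. \<iota> (star A (inv_into UNIV \<iota> x))),
     nrm = (\<lambda>x. nrm A (inv_into UNIV \<iota> x))\<rparr>"

definition transport_map :: "('a \<Rightarrow> 'u) \<Rightarrow> 'a cstar \<Rightarrow> ('a \<Rightarrow> 'a) \<Rightarrow> 'u \<Rightarrow> 'u" where
  "transport_map \<iota> A h = (\<lambda>x\<in>\<iota> ` carrier A. \<iota> (h (inv_into UNIV \<iota> x)))"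

lemma transport_id: "transport id A = A"
  by (simp add: transport_def)

lemma transport_map_id: "transport_map id A h = restrict h (carrier A)"
  by (simp add: transport_map_def)


section \<open>The functor\<close>

definition CD_map ::
  "nat \<Rightarrow> nat \<Rightarrow> (nat \<Rightarrow> nat \<Rightarrow> real) \<Rightarrow> (nat \<Rightarrow> complex) \<Rightarrow> nat \<Rightarrow> complex" where
  "CD_map n m f = (\<lambda>v\<in>carrier (Cn m). \<lambda>i\<in>{..<n}. \<Sum>j<m. complex_of_real (f i j) * v j)"

end

theory Submission
  imports Defs "HOL-Computational_Algebra.Fundamental_Theorem_Algebra"
begin

text \<open>
  A functor that is bijective on hom-sets and reaches every object up to isomorphism is an
  equivalence (\<open>is_equivalence_if_essentially_surjective\<close>), so three things have to be seen.

  Functoriality and full faithfulness come down to matrices. An arrow \<open>n \<rightarrow> m\<close> of the Kleisli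
  category is a stochastic matrix with \<open>n\<close> rows and \<open>m\<close> columns, Kleisli composition is the matrix
  product (\<open>Comp_KlN\<close>), and the functor lets a matrix act on column vectors, which reverses the
  direction of arrows. A linear map \<open>h : \<complex>\<^sup>m \<rightarrow> \<complex>\<^sup>n\<close> is
  determined by its values on the standard basis vectors. Since these are positive and sum to the
  unit, \<open>h\<close> is positive and unital exactly if its matrix has nonnegative entries and rows with
  sum \<open>1\<close> (\<open>bij_betw_CD_map\<close>).

  Essential surjectivity is the structure theorem \<open>ex_star_iso_Cn\<close>: every finite-dimensional
  commutative \<open>C\<^sup>*\<close>-algebra \<open>A\<close> is isomorphic to some \<open>\<complex>\<^sup>n\<close> as a star-algebra. By the
  \<open>C\<^sup>*\<close>-identity of the norm, \<open>x\<^sup>* x = 0\<close> forces \<open>x = 0\<close>, and it follows that \<open>A\<close> has no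
  nonzero nilpotent elements. Given an idempotent \<open>e \<noteq> 0\<close> and an element \<open>x\<close>, finite dimension
  provides a nonzero polynomial \<open>p\<close> of least degree with \<open>p(x) e = 0\<close>. Splitting off a root,
  \<open>p = (X - a) q\<close>, the element \<open>y = q(x) e\<close> is a nonzero eigenvector of \<open>x\<close>, so
  \<open>y\<^sup>2 = q(x) y = q(a) y\<close>; as \<open>y\<^sup>2 \<noteq> 0\<close>, a multiple of \<open>y\<close> is an idempotent below \<open>e\<close> on which
  \<open>x\<close> acts as a scalar (\<open>eigen_idempotent\<close>). Repeating this for each element of a finite
  generating set gives below \<open>e\<close> an idempotent \<open>f\<close> with \<open>A f = \<complex> f\<close> (\<open>ex_atom_below\<close>). Such atoms are
  pairwise orthogonal, hence linearly independent and finite in number. Their sum is the unit,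
  for otherwise there would be an atom below its complement. Hence \<open>A\<close> is the
  direct sum of the lines \<open>\<complex> f\<close>. Finally \<open>f\<^sup>*\<close> is again an atom and
  \<open>f\<^sup>* f \<noteq> 0\<close>, so \<open>f\<^sup>* = f\<close> by orthogonality, and the star of \<open>A\<close> is
  complex conjugation of coordinates.

  A star-isomorphism and its inverse are positive and unital, because
  positivity refers only to the star and the product, so this is an isomorphism in the category. The
  same applies to the injection by which \<open>\<complex>\<^sup>n\<close> is transported to another universe.
\<close>

section \<open>Equivalences of categories\<close>

lemma category_op_cat:
  assumes "category C"
  shows "category (op_cat C)"
proof -
  interpret category C by fact
  show ?thesis
    by unfold_locales
      (auto simp: op_cat_def ident_in_Hom comp_in_Hom comp_ident_left comp_ident_right comp_assoc)
qed

lemma Ob_op_cat: "Ob (op_cat C) = Ob C"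
  by (simp add: op_cat_def)

lemma is_iso_op_cat: "is_iso (op_cat C) X Y f \<longleftrightarrow> is_iso C Y X f"
  by (auto simp: is_iso_def op_cat_def)

locale fully_faithful_functor = cat_functor +
  assumes bij_on_Hom:
    "\<lbrakk>X \<in> Ob C; Y \<in> Ob C\<rbrakk> \<Longrightarrow> bij_betw (Fm X Y) (Hom C X Y) (Hom D (Fo X) (Fo Y))"
begin

lemma faithful:
  "\<lbrakk>X \<in> Ob C; Y \<in> Ob C; f \<in> Hom C X Y; g \<in> Hom C X Y; Fm X Y f = Fm X Y g\<rbrakk> \<Longrightarrow> f = g"
  using bij_on_Hom[of X Y] by (auto simp: bij_betw_def inj_on_def)

definition lift :: "'a \<Rightarrow> 'a \<Rightarrow> 'd \<Rightarrow> 'b" where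
  "lift X Y h = the_inv_into (Hom C X Y) (Fm X Y) h"

lemma
  assumes "X \<in> Ob C" "Y \<in> Ob C" "h \<in> Hom D (Fo X) (Fo Y)"
  shows lift_in_Hom: "lift X Y h \<in> Hom C X Y"
    and map_lift: "Fm X Y (lift X Y h) = h"
  using bij_on_Hom[OF assms(1,2)] assms(3) unfolding lift_def
  by (auto simp: bij_betw_def the_inv_into_into f_the_inv_into_f)

lemma lift_eqI:
  "\<lbrakk>X \<in> Ob C; Y \<in> Ob C; f \<in> Hom C X Y; Fm X Y f = h\<rbrakk> \<Longrightarrow> lift X Y h = f"
  using bij_on_Hom[of X Y] unfolding lift_def by (auto simp: bij_betw_def the_inv_into_f_f)

text \<open>Full faithfulness transports the two inverse laws back along the functor.\<close>

lemma lift_iso: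
  assumes X: "X \<in> Ob C" and Y: "Y \<in> Ob C" and h: "is_iso D (Fo X) (Fo Y) h"
  shows "is_iso C X Y (lift X Y h)"
proof -
  obtain k where hH: "h \<in> Hom D (Fo X) (Fo Y)" and kH: "k \<in> Hom D (Fo Y) (Fo X)"
    and kh: "Comp D (Fo X) (Fo Y) (Fo X) k h = Ident D (Fo X)"
    and hk: "Comp D (Fo Y) (Fo X) (Fo Y) h k = Ident D (Fo Y)"
    using h by (auto simp: is_iso_def)
  note L = lift_in_Hom[OF X Y hH] map_lift[OF X Y hH] lift_in_Hom[OF Y X kH] map_lift[OF Y X kH]
  have "Comp C X Y X (lift Y X k) (lift X Y h) = Ident C X"
    by (rule faithful[OF X X]) (simp_all add: X Y L kh dom.comp_in_Hom dom.ident_in_Hom map_comp map_ident)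
  moreover have "Comp C Y X Y (lift X Y h) (lift Y X k) = Ident C Y"
    by (rule faithful[OF Y Y]) (simp_all add: X Y L hk dom.comp_in_Hom dom.ident_in_Hom map_comp map_ident)
  ultimately show ?thesis
    using L by (auto simp: is_iso_def)
qed

text \<open>
  A quasi-inverse picks for every object \<open>A\<close> of \<open>D\<close> an object \<open>G A\<close> with an isomorphism
  \<open>\<epsilon> A : F (G A) \<rightarrow> A\<close>, and sends \<open>h : A \<rightarrow> B\<close> to the unique arrow over
  \<open>(\<epsilon> B)\<^sup>-\<^sup>1 \<circ> h \<circ> \<epsilon> A\<close>. The counit is then \<open>\<epsilon>\<close>, and the unit at \<open>X\<close> is the arrow over
  \<open>(\<epsilon> (F X))\<^sup>-\<^sup>1\<close>.
\<close>

theorem is_equivalence_if_essentially_surjective: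
  assumes surj: "\<And>A. A \<in> Ob D \<Longrightarrow> \<exists>X\<in>Ob C. \<exists>f. is_iso D (Fo X) A f"
  shows "is_equivalence C D Fo Fm"
proof -
  have "\<forall>A. \<exists>X e d. A \<in> Ob D \<longrightarrow> X \<in> Ob C \<and> e \<in> Hom D (Fo X) A \<and> d \<in> Hom D A (Fo X) \<and>
      Comp D (Fo X) A (Fo X) d e = Ident D (Fo X) \<and> Comp D A (Fo X) A e d = Ident D A"
    using surj unfolding is_iso_def by meson
  then obtain G \<epsilon> \<delta> where *: "\<And>A. A \<in> Ob D \<longrightarrow> G A \<in> Ob C \<and> \<epsilon> A \<in> Hom D (Fo (G A)) A \<and>
      \<delta> A \<in> Hom D A (Fo (G A)) \<and>
      Comp D (Fo (G A)) A (Fo (G A)) (\<delta> A) (\<epsilon> A) = Ident D (Fo (G A)) \<and>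
      Comp D A (Fo (G A)) A (\<epsilon> A) (\<delta> A) = Ident D A"
    by metis
  have G: "G A \<in> Ob C" and \<epsilon>: "\<epsilon> A \<in> Hom D (Fo (G A)) A" and \<delta>: "\<delta> A \<in> Hom D A (Fo (G A))"
    and \<delta>\<epsilon>: "Comp D (Fo (G A)) A (Fo (G A)) (\<delta> A) (\<epsilon> A) = Ident D (Fo (G A))"
    and \<epsilon>\<delta>: "Comp D A (Fo (G A)) A (\<epsilon> A) (\<delta> A) = Ident D A"
    if "A \<in> Ob D" for A
    using * that by auto
  have FG: "Fo (G A) \<in> Ob D" if "A \<in> Ob D" for A
    using G[OF that] by (rule map_Ob)
  define K where "K A B h = Comp D (Fo (G A)) B (Fo (G B)) (\<delta> B) (Comp D (Fo (G A)) A B h (\<epsilon> A))"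
    for A B h
  have K_in: "K A B h \<in> Hom D (Fo (G A)) (Fo (G B))"
    if "A \<in> Ob D" "B \<in> Ob D" "h \<in> Hom D A B" for A B h
    unfolding K_def using that by (intro cod.comp_in_Hom \<delta> \<epsilon> FG)
  have \<epsilon>K: "Comp D (Fo (G A)) (Fo (G B)) B (\<epsilon> B) (K A B h) = Comp D (Fo (G A)) A B h (\<epsilon> A)"
    if "A \<in> Ob D" "B \<in> Ob D" "h \<in> Hom D A B" for A B h
  proof -
    have c: "Comp D (Fo (G A)) A B h (\<epsilon> A) \<in> Hom D (Fo (G A)) B"
      using that by (intro cod.comp_in_Hom \<epsilon> FG)
    show ?thesis
      unfolding K_def
      using cod.comp_assoc[OF FG[OF that(1)] that(2) FG[OF that(2)] that(2) c \<delta>[OF that(2)] \<epsilon>[OF that(2)]]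
      by (simp add: \<epsilon>\<delta> that cod.comp_ident_left[OF FG[OF that(1)] that(2) c])
  qed
  \<comment> \<open>The counit components have left inverses, so they are monomorphisms.\<close>
  have cancel: "p = q"
    if A: "A \<in> Ob D" and X: "X \<in> Ob D" and p: "p \<in> Hom D X (Fo (G A))" and q: "q \<in> Hom D X (Fo (G A))"
      and eq: "Comp D X (Fo (G A)) A (\<epsilon> A) p = Comp D X (Fo (G A)) A (\<epsilon> A) q" for A X p q
  proof -
    have "r = Comp D X A (Fo (G A)) (\<delta> A) (Comp D X (Fo (G A)) A (\<epsilon> A) r)"
      if r: "r \<in> Hom D X (Fo (G A))" for r
      using cod.comp_assoc[OF X FG[OF A] A FG[OF A] r \<epsilon>[OF A] \<delta>[OF A]] \<delta>\<epsilon>[OF A]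
        cod.comp_ident_left[OF X FG[OF A] r] by simp
    then show ?thesis using p q eq by metis
  qed
  define Gm where "Gm A B h = lift (G A) (G B) (K A B h)" for A B h
  have Gm_in: "Gm A B h \<in> Hom C (G A) (G B)" and F_Gm: "Fm (G A) (G B) (Gm A B h) = K A B h"
    if "A \<in> Ob D" "B \<in> Ob D" "h \<in> Hom D A B" for A B h
    unfolding Gm_def using that by (simp_all add: lift_in_Hom map_lift G K_in)
  have K_ident: "K A A (Ident D A) = Ident D (Fo (G A))" if A: "A \<in> Ob D" for A
    unfolding K_def using A by (simp add: cod.comp_ident_left[OF FG[OF A] A \<epsilon>[OF A]] \<delta>\<epsilon>)
  have K_comp: "K A E (Comp D A B E g f) = Comp D (Fo (G A)) (Fo (G B)) (Fo (G E)) (K B E g) (K A B f)"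
    if A: "A \<in> Ob D" and B: "B \<in> Ob D" and E: "E \<in> Ob D"
      and f: "f \<in> Hom D A B" and g: "g \<in> Hom D B E" for A B E f g
  proof (rule cancel[OF E FG[OF A]])
    show "K A E (Comp D A B E g f) \<in> Hom D (Fo (G A)) (Fo (G E))"
      by (intro K_in cod.comp_in_Hom[OF A B E f g] A E)
    show "Comp D (Fo (G A)) (Fo (G B)) (Fo (G E)) (K B E g) (K A B f) \<in> Hom D (Fo (G A)) (Fo (G E))"
      by (intro cod.comp_in_Hom FG K_in A B E f g)
    have "Comp D (Fo (G A)) (Fo (G E)) E (\<epsilon> E)
        (Comp D (Fo (G A)) (Fo (G B)) (Fo (G E)) (K B E g) (K A B f))
      = Comp D (Fo (G A)) (Fo (G B)) E (Comp D (Fo (G B)) (Fo (G E)) E (\<epsilon> E) (K B E g)) (K A B f)"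
      by (intro cod.comp_assoc[symmetric] FG K_in \<epsilon> A B E f g)
    also have "\<dots> = Comp D (Fo (G A)) (Fo (G B)) E (Comp D (Fo (G B)) B E g (\<epsilon> B)) (K A B f)"
      by (simp add: \<epsilon>K B E g)
    also have "\<dots> = Comp D (Fo (G A)) B E g (Comp D (Fo (G A)) (Fo (G B)) B (\<epsilon> B) (K A B f))"
      by (intro cod.comp_assoc FG K_in \<epsilon> A B E f g)
    also have "\<dots> = Comp D (Fo (G A)) B E g (Comp D (Fo (G A)) A B f (\<epsilon> A))"
      by (simp add: \<epsilon>K A B f)
    also have "\<dots> = Comp D (Fo (G A)) A E (Comp D A B E g f) (\<epsilon> A)"
      by (intro cod.comp_assoc[symmetric] FG \<epsilon> A B E f g)
    also have "\<dots> = Comp D (Fo (G A)) (Fo (G E)) E (\<epsilon> E) (K A E (Comp D A B E g f))"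
      by (intro \<epsilon>K[symmetric] A E cod.comp_in_Hom[OF A B E f g])
    finally show "Comp D (Fo (G A)) (Fo (G E)) E (\<epsilon> E) (K A E (Comp D A B E g f))
      = Comp D (Fo (G A)) (Fo (G E)) E (\<epsilon> E)
        (Comp D (Fo (G A)) (Fo (G B)) (Fo (G E)) (K B E g) (K A B f))" by simp
  qed
  interpret Gf: cat_functor D C G Gm
  proof
    show "G A \<in> Ob C" if "A \<in> Ob D" for A by (rule G[OF that])
    show "Gm A B h \<in> Hom C (G A) (G B)" if "A \<in> Ob D" "B \<in> Ob D" "h \<in> Hom D A B" for A B h
      by (rule Gm_in[OF that])
    show "Gm A A (Ident D A) = Ident C (G A)" if A: "A \<in> Ob D" for A
      unfolding Gm_def
      by (rule lift_eqI) (simp_all add: A G dom.ident_in_Hom map_ident K_ident)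
    show "Gm A E (Comp D A B E g f) = Comp C (G A) (G B) (G E) (Gm B E g) (Gm A B f)"
      if "A \<in> Ob D" "B \<in> Ob D" "E \<in> Ob D" "f \<in> Hom D A B" "g \<in> Hom D B E" for A B E f g
      unfolding Gm_def[of A E]
      by (rule lift_eqI) (simp_all add: that G Gm_in dom.comp_in_Hom map_comp F_Gm K_comp)
  qed
  have idC: "cat_functor C C (\<lambda>X. X) (\<lambda>X Y f. f)"
    by unfold_locales auto
  have idD: "cat_functor D D (\<lambda>X. X) (\<lambda>X Y f. f)"
    by unfold_locales auto
  have GF: "cat_functor C C (\<lambda>X. G (Fo X)) (\<lambda>X Y f. Gm (Fo X) (Fo Y) (Fm X Y f))"
    by unfold_locales (simp_all add: map_Ob map_Hom G Gm_in map_ident map_comp Gf.map_ident Gf.map_comp)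
  have FGf: "cat_functor D D (\<lambda>A. Fo (G A)) (\<lambda>A B h. Fm (G A) (G B) (Gm A B h))"
    by unfold_locales (simp_all add: map_Ob map_Hom G Gm_in map_ident map_comp Gf.map_ident Gf.map_comp)
  have counit: "natural_iso D D (\<lambda>A. Fo (G A)) (\<lambda>A B h. Fm (G A) (G B) (Gm A B h))
      (\<lambda>A. A) (\<lambda>A B h. h) \<epsilon>"
  proof (intro natural_iso.intro natural_iso_axioms.intro FGf idD)
    show "is_iso D (Fo (G A)) A (\<epsilon> A)" if "A \<in> Ob D" for A
      using \<epsilon>[OF that] \<delta>[OF that] \<delta>\<epsilon>[OF that] \<epsilon>\<delta>[OF that] by (auto simp: is_iso_def)
    show "Comp D (Fo (G A)) (Fo (G B)) B (\<epsilon> B) (Fm (G A) (G B) (Gm A B h))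
        = Comp D (Fo (G A)) A B h (\<epsilon> A)"
      if "A \<in> Ob D" "B \<in> Ob D" "h \<in> Hom D A B" for A B h
      by (simp add: that F_Gm \<epsilon>K)
  qed
  define \<eta> where "\<eta> X = lift X (G (Fo X)) (\<delta> (Fo X))" for X
  have \<eta>_in: "\<eta> X \<in> Hom C X (G (Fo X))" and F_\<eta>: "Fm X (G (Fo X)) (\<eta> X) = \<delta> (Fo X)"
    if "X \<in> Ob C" for X
    unfolding \<eta>_def using that by (simp_all add: lift_in_Hom map_lift G map_Ob \<delta>)
  have unit: "natural_iso C C (\<lambda>X. X) (\<lambda>X Y f. f)
      (\<lambda>X. G (Fo X)) (\<lambda>X Y f. Gm (Fo X) (Fo Y) (Fm X Y f)) \<eta>"
  proof (intro natural_iso.intro natural_iso_axioms.intro idC GF)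
    show "is_iso C X (G (Fo X)) (\<eta> X)" if X: "X \<in> Ob C" for X
    proof -
      have FX: "Fo X \<in> Ob D" by (rule map_Ob[OF X])
      show ?thesis
        unfolding \<eta>_def
        by (rule lift_iso[OF X G[OF FX]])
          (use \<epsilon>[OF FX] \<delta>[OF FX] \<delta>\<epsilon>[OF FX] \<epsilon>\<delta>[OF FX] in \<open>auto simp: is_iso_def\<close>)
    qed
    show "Comp C X Y (G (Fo Y)) (\<eta> Y) f
        = Comp C X (G (Fo X)) (G (Fo Y)) (Gm (Fo X) (Fo Y) (Fm X Y f)) (\<eta> X)"
      if X: "X \<in> Ob C" and Y: "Y \<in> Ob C" and f: "f \<in> Hom C X Y" for X Y f
    proof (rule faithful[OF X G[OF map_Ob[OF Y]]])
      note FX = map_Ob[OF X] and FY = map_Ob[OF Y] and Ff = map_Hom[OF X Y f]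
      note GX = G[OF FX] and GY = G[OF FY]
      show "Comp C X Y (G (Fo Y)) (\<eta> Y) f \<in> Hom C X (G (Fo Y))"
        by (intro dom.comp_in_Hom X Y GY f \<eta>_in)
      show "Comp C X (G (Fo X)) (G (Fo Y)) (Gm (Fo X) (Fo Y) (Fm X Y f)) (\<eta> X) \<in> Hom C X (G (Fo Y))"
        by (intro dom.comp_in_Hom X Y GX GY \<eta>_in Gm_in FX FY Ff)
      have k: "K (Fo X) (Fo Y) (Fm X Y f) \<in> Hom D (Fo (G (Fo X))) (Fo (G (Fo Y)))"
        by (rule K_in[OF FX FY Ff])
      have "Comp D (Fo X) (Fo Y) (Fo (G (Fo Y))) (\<delta> (Fo Y)) (Fm X Y f)
        = Comp D (Fo X) (Fo (G (Fo X))) (Fo (G (Fo Y))) (K (Fo X) (Fo Y) (Fm X Y f)) (\<delta> (Fo X))"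
      proof (rule cancel[OF FY FX])
        show "Comp D (Fo X) (Fo Y) (Fo (G (Fo Y))) (\<delta> (Fo Y)) (Fm X Y f) \<in> Hom D (Fo X) (Fo (G (Fo Y)))"
          by (intro cod.comp_in_Hom FG FX FY Ff \<delta>)
        show "Comp D (Fo X) (Fo (G (Fo X))) (Fo (G (Fo Y))) (K (Fo X) (Fo Y) (Fm X Y f)) (\<delta> (Fo X))
            \<in> Hom D (Fo X) (Fo (G (Fo Y)))"
          by (intro cod.comp_in_Hom FG FX FY k \<delta>)
        show "Comp D (Fo X) (Fo (G (Fo Y))) (Fo Y) (\<epsilon> (Fo Y))
              (Comp D (Fo X) (Fo Y) (Fo (G (Fo Y))) (\<delta> (Fo Y)) (Fm X Y f))
            = Comp D (Fo X) (Fo (G (Fo Y))) (Fo Y) (\<epsilon> (Fo Y))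
              (Comp D (Fo X) (Fo (G (Fo X))) (Fo (G (Fo Y))) (K (Fo X) (Fo Y) (Fm X Y f)) (\<delta> (Fo X)))"
          using cod.comp_assoc[OF FX FY FG[OF FY] FY Ff \<delta>[OF FY] \<epsilon>[OF FY]]
            cod.comp_assoc[OF FX FG[OF FX] FG[OF FY] FY \<delta>[OF FX] k \<epsilon>[OF FY]]
            cod.comp_assoc[OF FX FG[OF FX] FX FY \<delta>[OF FX] \<epsilon>[OF FX] Ff]
          by (simp add: \<epsilon>\<delta> FX FY Ff \<epsilon>K cod.comp_ident_left cod.comp_ident_right)
      qed
      then show "Fm X (G (Fo Y)) (Comp C X Y (G (Fo Y)) (\<eta> Y) f)
        = Fm X (G (Fo Y)) (Comp C X (G (Fo X)) (G (Fo Y)) (Gm (Fo X) (Fo Y) (Fm X Y f)) (\<eta> X))"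
        by (simp add: X Y f FX FY Ff GX GY \<eta>_in F_\<eta> Gm_in F_Gm map_comp)
    qed
  qed
  show ?thesis
    unfolding is_equivalence_def
    using cat_functor_axioms Gf.cat_functor_axioms unit counit by blast
qed

end

section \<open>Positive unital maps and star-homomorphisms\<close>

lemma (in comm_cstar_algebra) cstar_vectorspace: "vectorspace (class_ring :: complex ring) A"
  by (intro vectorspace.intro module class_field)

text \<open>
  The module axioms, restated with the operations of \<open>\<complex>\<close> in place of those of the
  ring record, so that they can serve as rewrite rules.
\<close>

lemma (in comm_cstar_algebra) smult_simps:
  assumes "x \<in> carrier A"
  shows smult_in: "a \<odot>\<^bsub>A\<^esub> x \<in> carrier A"
    and smult_plus_left: "(a + b) \<odot>\<^bsub>A\<^esub> x = a \<odot>\<^bsub>A\<^esub> x \<oplus>\<^bsub>A\<^esub> b \<odot>\<^bsub>A\<^esub> x"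
    and smult_times_left: "(a * b) \<odot>\<^bsub>A\<^esub> x = a \<odot>\<^bsub>A\<^esub> (b \<odot>\<^bsub>A\<^esub> x)"
    and smult_1_left: "1 \<odot>\<^bsub>A\<^esub> x = x"
    and smult_0_left: "0 \<odot>\<^bsub>A\<^esub> x = \<zero>\<^bsub>A\<^esub>"
  using assms smult_closed[of a x] smult_l_distr[of a b x] smult_assoc1[of a b x] smult_one[of x]
    smult_l_null[of x]
  by simp_all

lemma pu_mapI:
  assumes "\<And>x. x \<in> carrier A \<Longrightarrow> f x \<in> carrier B"
    and "\<And>x y. \<lbrakk>x \<in> carrier A; y \<in> carrier A\<rbrakk> \<Longrightarrow> f (x \<oplus>\<^bsub>A\<^esub> y) = f x \<oplus>\<^bsub>B\<^esub> f y"
    and "\<And>c x. x \<in> carrier A \<Longrightarrow> f (c \<odot>\<^bsub>A\<^esub> x) = c \<odot>\<^bsub>B\<^esub> f x"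
    and "\<And>x. \<lbrakk>x \<in> carrier A; cstar_positive A x\<rbrakk> \<Longrightarrow> cstar_positive B (f x)"
    and "f \<one>\<^bsub>A\<^esub> = \<one>\<^bsub>B\<^esub>"
  shows "pu_map A B f"
  using assms by (auto simp: pu_map_def LinearCombinations.module_hom_def)

lemma
  assumes "pu_map A B f"
  shows pu_map_closed: "x \<in> carrier A \<Longrightarrow> f x \<in> carrier B"
    and pu_map_add: "\<lbrakk>x \<in> carrier A; y \<in> carrier A\<rbrakk> \<Longrightarrow> f (x \<oplus>\<^bsub>A\<^esub> y) = f x \<oplus>\<^bsub>B\<^esub> f y"
    and pu_map_smult: "x \<in> carrier A \<Longrightarrow> f (c \<odot>\<^bsub>A\<^esub> x) = c \<odot>\<^bsub>B\<^esub> f x"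
    and pu_map_positive: "\<lbrakk>x \<in> carrier A; cstar_positive A x\<rbrakk> \<Longrightarrow> cstar_positive B (f x)"
    and pu_map_one: "f \<one>\<^bsub>A\<^esub> = \<one>\<^bsub>B\<^esub>"
  using assms by (auto simp: pu_map_def LinearCombinations.module_hom_def)

lemma pu_map_comp:
  assumes "pu_map A B f" "pu_map B C g"
  shows "pu_map A C (\<lambda>x. g (f x))"
  by (intro pu_mapI)
    (simp_all add: assms[THEN pu_map_closed] assms[THEN pu_map_add] assms[THEN pu_map_smult]
      assms[THEN pu_map_positive] assms[THEN pu_map_one])

text \<open>
  Arrows of the category are restricted to the carrier of their source, while the natural formulas
  for them are not; this lemma passes between the two.
\<close>

lemma (in comm_cstar_algebra) pu_map_cong:
  assumes "pu_map A B f" and eq: "\<And>x. x \<in> carrier A \<Longrightarrow> g x = f x"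
  shows "pu_map A B g"
  by (intro pu_mapI)
    (simp_all add: eq assms(1)[THEN pu_map_closed] assms(1)[THEN pu_map_add]
      assms(1)[THEN pu_map_smult] assms(1)[THEN pu_map_positive] assms(1)[THEN pu_map_one])

text \<open>
  Positivity, and with it isomorphism in the category of positive unital maps, is expressed by
  the linear structure, the unit, the product and the star, so these are what is preserved.
\<close>

definition star_hom :: "'a cstar \<Rightarrow> 'b cstar \<Rightarrow> ('a \<Rightarrow> 'b) \<Rightarrow> bool" where
  "star_hom A B f \<longleftrightarrow> f \<in> carrier A \<rightarrow> carrier B \<and>
     (\<forall>x\<in>carrier A. \<forall>y\<in>carrier A. f (x \<oplus>\<^bsub>A\<^esub> y) = f x \<oplus>\<^bsub>B\<^esub> f y \<and> f (x \<otimes>\<^bsub>A\<^esub> y) = f x \<otimes>\<^bsub>B\<^esub> f y) \<and>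
     (\<forall>x\<in>carrier A. (\<forall>c. f (c \<odot>\<^bsub>A\<^esub> x) = c \<odot>\<^bsub>B\<^esub> f x) \<and> f (star A x) = star B (f x)) \<and>
     f \<one>\<^bsub>A\<^esub> = \<one>\<^bsub>B\<^esub>"

lemma (in comm_cstar_algebra) star_hom_pu_map:
  assumes "star_hom A B f"
  shows "pu_map A B f"
  using assms
  by (intro pu_mapI) (auto simp: star_hom_def cstar_positive_def Pi_iff star_closed)

lemma (in comm_cstar_algebra) star_hom_inv_into:
  assumes f: "star_hom A B f" and bij: "bij_betw f (carrier A) (carrier B)"
  shows "star_hom B A (inv_into (carrier A) f)"
proof -
  have inj: "inj_on f (carrier A)" and im: "carrier B = f ` carrier A"
    using bij by (auto simp: bij_betw_def)
  have inv: "inv_into (carrier A) f (f x) = x" if "x \<in> carrier A" for x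
    using inj that by (rule inv_into_f_f)
  have *: "f x \<oplus>\<^bsub>B\<^esub> f y = f (x \<oplus>\<^bsub>A\<^esub> y)" "f x \<otimes>\<^bsub>B\<^esub> f y = f (x \<otimes>\<^bsub>A\<^esub> y)"
    "c \<odot>\<^bsub>B\<^esub> f x = f (c \<odot>\<^bsub>A\<^esub> x)" "star B (f x) = f (star A x)" "\<one>\<^bsub>B\<^esub> = f \<one>\<^bsub>A\<^esub>"
    if "x \<in> carrier A" "y \<in> carrier A" for x y c
    using f that by (auto simp: star_hom_def)
  have one: "\<one>\<^bsub>B\<^esub> = f \<one>\<^bsub>A\<^esub>" using f by (simp add: star_hom_def)
  show ?thesis
    unfolding star_hom_def im by (auto simp: * one inv star_closed)
qed

section \<open>The category of finite-dimensional commutative \<open>C\<^sup>*\<close>-algebras\<close>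

lemma category_FdCCstar_PU: "category FdCCstar_PU"
proof
  show "Ident FdCCstar_PU X \<in> Hom FdCCstar_PU X X" if "X \<in> Ob FdCCstar_PU"
    for X :: "'a cstar"
  proof -
    interpret comm_cstar_algebra X using that by (simp add: FdCCstar_PU_def)
    show ?thesis
      by (auto simp: FdCCstar_PU_def intro!: pu_mapI)
  qed
  show "Comp FdCCstar_PU X Y Z g f \<in> Hom FdCCstar_PU X Z"
    if "X \<in> Ob FdCCstar_PU" "f \<in> Hom FdCCstar_PU X Y" "g \<in> Hom FdCCstar_PU Y Z"
    for X Y Z :: "'a cstar" and f g
  proof -
    interpret comm_cstar_algebra X using that by (simp add: FdCCstar_PU_def)
    show ?thesis
      using that
      by (auto simp: FdCCstar_PU_def compose_def intro: pu_map_cong[OF pu_map_comp[of X Y f Z g]])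
  qed
qed (auto simp: FdCCstar_PU_def compose_def pu_map_closed fun_eq_iff extensional_def restrict_def)

lemma is_iso_FdCCstar_PU_if_star_iso:
  assumes A: "comm_cstar_algebra A" and B: "comm_cstar_algebra B"
    and f: "star_hom A B f" and bij: "bij_betw f (carrier A) (carrier B)"
  shows "is_iso FdCCstar_PU A B (restrict f (carrier A))"
proof -
  interpret A: comm_cstar_algebra A by fact
  interpret B: comm_cstar_algebra B by fact
  let ?g = "inv_into (carrier A) f"
  have g: "star_hom B A ?g" by (rule A.star_hom_inv_into[OF f bij])
  have "restrict f (carrier A) \<in> Hom FdCCstar_PU A B"
    using A.pu_map_cong[OF A.star_hom_pu_map[OF f], of "restrict f (carrier A)"]
    by (simp add: FdCCstar_PU_def)
  moreover have "restrict ?g (carrier B) \<in> Hom FdCCstar_PU B A"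
    using B.pu_map_cong[OF B.star_hom_pu_map[OF g], of "restrict ?g (carrier B)"]
    by (simp add: FdCCstar_PU_def)
  moreover have "f x \<in> carrier B" "?g (f x) = x" if "x \<in> carrier A" for x
    using bij that by (auto simp: bij_betw_def)
  moreover have "?g y \<in> carrier A" "f (?g y) = y" if "y \<in> carrier B" for y
    using bij that by (auto simp: bij_betw_def intro: inv_into_into f_inv_into_f)
  ultimately show ?thesis
    unfolding is_iso_def
    by (intro conjI bexI[of _ "restrict ?g (carrier B)"])
      (auto simp: FdCCstar_PU_def compose_def fun_eq_iff restrict_def)
qed

section \<open>The algebras \<open>\<complex>\<^sup>n\<close>\<close>

lemma Cn_simps [simp]:
  "carrier (Cn n) = {..<n} \<rightarrow>\<^sub>E UNIV"
  "\<one>\<^bsub>Cn n\<^esub> = (\<lambda>i\<in>{..<n}. 1)"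
  "\<zero>\<^bsub>Cn n\<^esub> = (\<lambda>i\<in>{..<n}. 0)"
  "v \<otimes>\<^bsub>Cn n\<^esub> w = (\<lambda>i\<in>{..<n}. v i * w i)"
  "v \<oplus>\<^bsub>Cn n\<^esub> w = (\<lambda>i\<in>{..<n}. v i + w i)"
  "c \<odot>\<^bsub>Cn n\<^esub> v = (\<lambda>i\<in>{..<n}. c * v i)"
  "star (Cn n) v = (\<lambda>i\<in>{..<n}. cnj (v i))"
  by (simp_all add: Cn_def)

lemma Cn_eq_iff:
  "\<lbrakk>v \<in> carrier (Cn n); w \<in> carrier (Cn n)\<rbrakk> \<Longrightarrow> v = w \<longleftrightarrow> (\<forall>i<n. v i = w i)"
  by (auto intro: PiE_ext)

lemma Cn_cring: "cring (Cn n)"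
proof (intro cringI abelian_groupI comm_monoidI)
  fix x assume "x \<in> carrier (Cn n)"
  then show "\<exists>y\<in>carrier (Cn n). y \<oplus>\<^bsub>Cn n\<^esub> x = \<zero>\<^bsub>Cn n\<^esub>"
    by (intro bexI[of _ "\<lambda>i\<in>{..<n}. - x i"]) (auto cong: restrict_cong)
qed (auto simp: algebra_simps cong: restrict_cong)

lemma Cn_algebra: "algebra (class_ring :: complex ring) (Cn n)"
  by (intro algebraI Cn_cring class_cring.is_cring)
    (auto simp: algebra_simps cong: restrict_cong)

lemma Cn_minus:
  assumes "v \<in> carrier (Cn n)" "w \<in> carrier (Cn n)"
  shows "v \<ominus>\<^bsub>Cn n\<^esub> w = (\<lambda>i\<in>{..<n}. v i - w i)"
proof -
  interpret cring "Cn n" by (rule Cn_cring)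
  have "\<ominus>\<^bsub>Cn n\<^esub> w = (\<lambda>i\<in>{..<n}. - w i)"
    using assms by (intro minus_equality) (auto cong: restrict_cong)
  then show ?thesis
    by (simp add: a_minus_def cong: restrict_cong)
qed

text \<open>
  This equivalence and \<open>nrm_Cn_attained\<close> determine the maximum norm; the norm axioms follow from
  them one coordinate at a time.
\<close>

lemma nrm_Cn_le_iff: "nrm (Cn n) v \<le> c \<longleftrightarrow> 0 \<le> c \<and> (\<forall>i<n. cmod (v i) \<le> c)"
  by (auto simp: Cn_def)

lemma nrm_Cn_nonneg: "0 \<le> nrm (Cn n) v"
  using nrm_Cn_le_iff[of n v "nrm (Cn n) v"] by simp

lemma cmod_le_nrm_Cn: "i < n \<Longrightarrow> cmod (v i) \<le> nrm (Cn n) v"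
  using nrm_Cn_le_iff[of n v "nrm (Cn n) v"] by simp

lemma nrm_Cn_attained: "nrm (Cn n) v = 0 \<or> (\<exists>i<n. nrm (Cn n) v = cmod (v i))"
  using Max_in[of "insert 0 ((\<lambda>i. cmod (v i)) ` {..<n})"] by (auto simp: Cn_def)

text \<open>
  A Cauchy sequence converges in each coordinate, and the maximum norm is dominated by the sum of
  the finitely many coordinate distances.
\<close>

lemma Cn_complete:
  assumes s: "\<And>k. s k \<in> carrier (Cn n)"
    and cauchy: "\<And>e. e > 0 \<Longrightarrow> \<exists>N. \<forall>k\<ge>N. \<forall>l\<ge>N. nrm (Cn n) (s k \<ominus>\<^bsub>Cn n\<^esub> s l) < e"
  shows "\<exists>x\<in>carrier (Cn n). (\<lambda>k. nrm (Cn n) (s k \<ominus>\<^bsub>Cn n\<^esub> x)) \<longlonglongrightarrow> 0"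
proof -
  have "Cauchy (\<lambda>k. s k i)" if i: "i < n" for i
  proof (rule CauchyI)
    fix e :: real assume "e > 0"
    then obtain N where N: "\<And>k l. \<lbrakk>k \<ge> N; l \<ge> N\<rbrakk> \<Longrightarrow> nrm (Cn n) (s k \<ominus>\<^bsub>Cn n\<^esub> s l) < e"
      using cauchy by blast
    have "cmod (s k i - s l i) < e" if "k \<ge> N" "l \<ge> N" for k l
      using cmod_le_nrm_Cn[OF i, of "s k \<ominus>\<^bsub>Cn n\<^esub> s l"] N[OF that] i
      by (simp add: Cn_minus s del: Cn_simps)
    then show "\<exists>M. \<forall>k\<ge>M. \<forall>l\<ge>M. cmod (s k i - s l i) < e" by blast
  qed
  then have "\<forall>i. \<exists>y. i < n \<longrightarrow> (\<lambda>k. s k i) \<longlonglongrightarrow> y"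
    by (meson Cauchy_convergent convergent_def)
  then obtain y where y: "\<And>i. i < n \<Longrightarrow> (\<lambda>k. s k i) \<longlonglongrightarrow> y i" by metis
  define x where "x = restrict y {..<n}"
  have x: "x \<in> carrier (Cn n)" by (simp add: x_def)
  have "(\<lambda>k. \<Sum>i<n. cmod (s k i - y i)) \<longlonglongrightarrow> (\<Sum>i<n. 0)"
    by (intro tendsto_sum tendsto_norm_zero) (use y in \<open>auto simp: LIM_zero_iff\<close>)
  then have lim: "(\<lambda>k. \<Sum>i<n. cmod (s k i - y i)) \<longlonglongrightarrow> 0" by simp
  have bound: "norm (nrm (Cn n) (s k \<ominus>\<^bsub>Cn n\<^esub> x)) \<le> norm (\<Sum>i<n. cmod (s k i - y i)) * 1" for k
  proof -
    have "cmod ((s k \<ominus>\<^bsub>Cn n\<^esub> x) i) \<le> (\<Sum>i<n. cmod (s k i - y i))" if "i < n" for i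
    proof -
      have "cmod ((s k \<ominus>\<^bsub>Cn n\<^esub> x) i) = cmod (s k i - y i)"
        using that by (simp add: Cn_minus s x del: Cn_simps) (simp add: x_def)
      also have "\<dots> \<le> (\<Sum>i<n. cmod (s k i - y i))"
        using that by (intro member_le_sum) auto
      finally show ?thesis .
    qed
    then show ?thesis
      by (simp add: nrm_Cn_nonneg nrm_Cn_le_iff sum_nonneg del: Cn_simps)
  qed
  have "(\<lambda>k. nrm (Cn n) (s k \<ominus>\<^bsub>Cn n\<^esub> x)) \<longlonglongrightarrow> 0"
    by (rule tendsto_0_le[OF lim always_eventually]) (rule allI, rule bound)
  then show ?thesis using x by blast
qed

lemma Cn_comm_cstar_algebra: "comm_cstar_algebra (Cn n)"
proof (intro comm_cstar_algebra.intro comm_cstar_algebra_axioms.intro Cn_algebra)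
  fix v w :: "nat \<Rightarrow> complex" and c :: complex
  assume v: "v \<in> carrier (Cn n)"
  then show "star (Cn n) v \<in> carrier (Cn n)" "star (Cn n) (star (Cn n) v) = v"
    "star (Cn n) (c \<odot>\<^bsub>Cn n\<^esub> v) = cnj c \<odot>\<^bsub>Cn n\<^esub> star (Cn n) v"
    by (auto cong: restrict_cong)
  show "0 \<le> nrm (Cn n) v" by (rule nrm_Cn_nonneg)
  have "nrm (Cn n) v \<le> 0 \<longleftrightarrow> (\<forall>i<n. v i = 0)" by (simp add: nrm_Cn_le_iff)
  then show "nrm (Cn n) v = 0 \<longleftrightarrow> v = \<zero>\<^bsub>Cn n\<^esub>"
    using v nrm_Cn_nonneg[of n v] by (subst Cn_eq_iff[of _ n]) auto
  show "nrm (Cn n) (c \<odot>\<^bsub>Cn n\<^esub> v) = cmod c * nrm (Cn n) v"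
  proof (rule antisym)
    show "nrm (Cn n) (c \<odot>\<^bsub>Cn n\<^esub> v) \<le> cmod c * nrm (Cn n) v"
      by (auto simp: nrm_Cn_le_iff nrm_Cn_nonneg norm_mult intro!: mult_left_mono cmod_le_nrm_Cn)
    show "cmod c * nrm (Cn n) v \<le> nrm (Cn n) (c \<odot>\<^bsub>Cn n\<^esub> v)"
      using nrm_Cn_attained[of n v]
    proof (elim disjE exE conjE)
      fix i assume "i < n" "nrm (Cn n) v = cmod (v i)"
      then show ?thesis
        using cmod_le_nrm_Cn[of i n "c \<odot>\<^bsub>Cn n\<^esub> v"] by (simp add: norm_mult)
    qed (simp add: nrm_Cn_nonneg)
  qed
  show "nrm (Cn n) (star (Cn n) v \<otimes>\<^bsub>Cn n\<^esub> v) = (nrm (Cn n) v)\<^sup>2"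
  proof (rule antisym)
    show "nrm (Cn n) (star (Cn n) v \<otimes>\<^bsub>Cn n\<^esub> v) \<le> (nrm (Cn n) v)\<^sup>2"
      by (auto simp: nrm_Cn_le_iff norm_mult power2_eq_square nrm_Cn_nonneg
          intro!: mult_mono cmod_le_nrm_Cn)
    show "(nrm (Cn n) v)\<^sup>2 \<le> nrm (Cn n) (star (Cn n) v \<otimes>\<^bsub>Cn n\<^esub> v)"
      using nrm_Cn_attained[of n v]
    proof (elim disjE exE conjE)
      fix i assume "i < n" "nrm (Cn n) v = cmod (v i)"
      then show ?thesis
        using cmod_le_nrm_Cn[of i n "star (Cn n) v \<otimes>\<^bsub>Cn n\<^esub> v"]
        by (simp add: norm_mult power2_eq_square)
    qed (simp add: nrm_Cn_nonneg)
  qed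
  assume w: "w \<in> carrier (Cn n)"
  show "star (Cn n) (v \<oplus>\<^bsub>Cn n\<^esub> w) = star (Cn n) v \<oplus>\<^bsub>Cn n\<^esub> star (Cn n) w"
    "star (Cn n) (v \<otimes>\<^bsub>Cn n\<^esub> w) = star (Cn n) w \<otimes>\<^bsub>Cn n\<^esub> star (Cn n) v"
    by (auto simp: mult.commute cong: restrict_cong)
  show "nrm (Cn n) (v \<oplus>\<^bsub>Cn n\<^esub> w) \<le> nrm (Cn n) v + nrm (Cn n) w"
    by (auto simp: nrm_Cn_le_iff nrm_Cn_nonneg
        intro!: norm_triangle_le add_mono cmod_le_nrm_Cn)
  show "nrm (Cn n) (v \<otimes>\<^bsub>Cn n\<^esub> w) \<le> nrm (Cn n) v * nrm (Cn n) w"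
    by (auto simp: nrm_Cn_le_iff nrm_Cn_nonneg norm_mult intro!: mult_mono cmod_le_nrm_Cn)
qed (rule Cn_complete)

abbreviation delta_vec :: "nat \<Rightarrow> nat \<Rightarrow> nat \<Rightarrow> complex" where
  "delta_vec n j \<equiv> \<lambda>i\<in>{..<n}. if i = j then 1 else 0"

lemma finsum_Cn:
  assumes "\<And>s. s \<in> S \<Longrightarrow> g s \<in> carrier (Cn n)"
  shows "finsum (Cn n) g S = (\<lambda>i\<in>{..<n}. \<Sum>s\<in>S. g s i)"
proof -
  interpret cring "Cn n" by (rule Cn_cring)
  show ?thesis using assms
    by (induction S rule: infinite_finite_induct) (simp_all add: Pi_iff cong: restrict_cong)
qed

lemma Cn_sum_delta_vec:
  assumes "v \<in> carrier (Cn n)"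
  shows "v = finsum (Cn n) (\<lambda>j. v j \<odot>\<^bsub>Cn n\<^esub> delta_vec n j) {..<n}"
proof -
  have "finsum (Cn n) (\<lambda>j. v j \<odot>\<^bsub>Cn n\<^esub> delta_vec n j) {..<n}
      = (\<lambda>i\<in>{..<n}. \<Sum>j<n. (v j \<odot>\<^bsub>Cn n\<^esub> delta_vec n j) i)"
    by (rule finsum_Cn) auto
  also have "\<dots> = (\<lambda>i\<in>{..<n}. \<Sum>j<n. if i = j then v j else 0)"
    by (intro restrict_ext sum.cong) auto
  also have "\<dots> = v"
    using assms by (simp add: sum.delta' cong: restrict_cong)
  finally show ?thesis by simp
qed

lemma Cn_fin_dim: "vectorspace.fin_dim (class_ring :: complex ring) (Cn n)"
proof -
  interpret comm_cstar_algebra "Cn n" by (rule Cn_comm_cstar_algebra)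
  interpret vectorspace "class_ring :: complex ring" "Cn n" by (rule cstar_vectorspace)
  let ?U = "delta_vec n ` {..<n}"
  have U: "?U \<subseteq> carrier (Cn n)" by (rule image_subsetI) simp
  have inj: "inj_on (delta_vec n) {..<n}"
    by (auto simp: inj_on_def fun_eq_iff restrict_def split: if_splits)
  have "v \<in> span ?U" if v: "v \<in> carrier (Cn n)" for v
  proof -
    define a where "a u = v (inv_into {..<n} (delta_vec n) u)" for u
    have a: "a (delta_vec n j) = v j" if "j < n" for j
      using inv_into_f_f[OF inj] that by (simp add: a_def)
    have "lincomb a ?U = finsum (Cn n) (\<lambda>j. a (delta_vec n j) \<odot>\<^bsub>Cn n\<^esub> delta_vec n j) {..<n}"
      unfolding lincomb_def by (rule finsum_reindex[OF _ inj]) auto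
    also have "\<dots> = finsum (Cn n) (\<lambda>j. v j \<odot>\<^bsub>Cn n\<^esub> delta_vec n j) {..<n}"
      by (rule finsum_cong') (auto simp: a)
    also have "\<dots> = v" using Cn_sum_delta_vec[OF v] by simp
    finally show ?thesis
      unfolding span_def by (auto intro!: exI[of _ a] exI[of _ ?U])
  qed
  moreover have "span ?U \<subseteq> carrier (Cn n)" by (rule span_is_subset2[OF U])
  ultimately show ?thesis
    unfolding fin_dim_def using U by (intro exI[of _ ?U]) auto
qed

section \<open>Transport of structure to another universe\<close>

lemma transport_simps [simp]:
  "carrier (transport \<iota> A) = \<iota> ` carrier A"
  "\<one>\<^bsub>transport \<iota> A\<^esub> = \<iota> \<one>\<^bsub>A\<^esub>"
  "\<zero>\<^bsub>transport \<iota> A\<^esub> = \<iota> \<zero>\<^bsub>A\<^esub>"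
  "inj \<iota> \<Longrightarrow> \<iota> v \<otimes>\<^bsub>transport \<iota> A\<^esub> \<iota> w = \<iota> (v \<otimes>\<^bsub>A\<^esub> w)"
  "inj \<iota> \<Longrightarrow> \<iota> v \<oplus>\<^bsub>transport \<iota> A\<^esub> \<iota> w = \<iota> (v \<oplus>\<^bsub>A\<^esub> w)"
  "inj \<iota> \<Longrightarrow> c \<odot>\<^bsub>transport \<iota> A\<^esub> \<iota> v = \<iota> (c \<odot>\<^bsub>A\<^esub> v)"
  "inj \<iota> \<Longrightarrow> star (transport \<iota> A) (\<iota> v) = \<iota> (star A v)"
  "inj \<iota> \<Longrightarrow> nrm (transport \<iota> A) (\<iota> v) = nrm A v"
  by (simp_all add: transport_def)

lemma star_hom_transport: "inj \<iota> \<Longrightarrow> star_hom A (transport \<iota> A) \<iota>"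
  by (simp add: star_hom_def)

lemma (in comm_cstar_algebra) transport_cring:
  assumes \<iota>: "inj \<iota>"
  shows "cring (transport \<iota> A)"
proof (intro cringI abelian_groupI comm_monoidI)
  fix x assume "x \<in> carrier (transport \<iota> A)"
  then obtain v where "v \<in> carrier A" "x = \<iota> v" by auto
  then show "\<exists>y\<in>carrier (transport \<iota> A). y \<oplus>\<^bsub>transport \<iota> A\<^esub> x = \<zero>\<^bsub>transport \<iota> A\<^esub>"
    using \<iota> M.l_neg by (intro bexI[of _ "\<iota> (\<ominus>\<^bsub>A\<^esub> v)"]) auto
qed (use \<iota> in \<open>auto simp: M.a_ac m_ac l_distr r_distr\<close>)

lemma (in comm_cstar_algebra) transport_comm_cstar_algebra:
  assumes \<iota>: "inj \<iota>"
  shows "comm_cstar_algebra (transport \<iota> A)"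
proof -
  interpret T: cring "transport \<iota> A" by (rule transport_cring[OF \<iota>])
  have alg: "algebra (class_ring :: complex ring) (transport \<iota> A)"
    by (intro algebraI transport_cring[OF \<iota>] class_cring.is_cring)
      (use \<iota> in \<open>auto simp: smult_r_distr smult_assoc2 smult_plus_left smult_times_left
        smult_1_left\<close>)
  have minus: "\<iota> v \<ominus>\<^bsub>transport \<iota> A\<^esub> \<iota> w = \<iota> (v \<ominus>\<^bsub>A\<^esub> w)"
    if "v \<in> carrier A" "w \<in> carrier A" for v w
  proof -
    have "\<ominus>\<^bsub>transport \<iota> A\<^esub> \<iota> w = \<iota> (\<ominus>\<^bsub>A\<^esub> w)"
      using that \<iota> by (intro T.minus_equality) (auto simp: M.l_neg)
    then show ?thesis using \<iota> by (simp add: a_minus_def)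
  qed
  have complete: "\<exists>x\<in>carrier (transport \<iota> A). (\<lambda>k. nrm (transport \<iota> A) (s k \<ominus>\<^bsub>transport \<iota> A\<^esub> x)) \<longlonglongrightarrow> 0"
    if s: "\<And>k. s k \<in> carrier (transport \<iota> A)"
      and cauchy: "\<And>e. e > 0 \<Longrightarrow>
        \<exists>N. \<forall>k\<ge>N. \<forall>l\<ge>N. nrm (transport \<iota> A) (s k \<ominus>\<^bsub>transport \<iota> A\<^esub> s l) < e" for s
  proof -
    from s have "\<forall>k. \<exists>v. v \<in> carrier A \<and> s k = \<iota> v" by auto
    then obtain t where t: "\<And>k. t k \<in> carrier A" "\<And>k. s k = \<iota> (t k)" by metis
    have "\<exists>x\<in>carrier A. (\<lambda>k. nrm A (t k \<ominus>\<^bsub>A\<^esub> x)) \<longlonglongrightarrow> 0"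
      using cauchy t(1) \<iota> by (intro nrm_complete) (auto simp: t(2) minus)
    then show ?thesis
      using t \<iota> by (auto simp: minus)
  qed
  show ?thesis
  proof (intro comm_cstar_algebra.intro comm_cstar_algebra_axioms.intro alg)
    fix s :: "nat \<Rightarrow> 'b"
    assume "\<And>k. s k \<in> carrier (transport \<iota> A)"
      and "\<And>e. e > 0 \<Longrightarrow>
        \<exists>N. \<forall>k\<ge>N. \<forall>l\<ge>N. nrm (transport \<iota> A) (s k \<ominus>\<^bsub>transport \<iota> A\<^esub> s l) < e"
    then show "\<exists>x\<in>carrier (transport \<iota> A).
        (\<lambda>k. nrm (transport \<iota> A) (s k \<ominus>\<^bsub>transport \<iota> A\<^esub> x)) \<longlonglongrightarrow> 0"
      by (rule complete)
  qed (use \<iota> in \<open>auto simp: star_closed star_star star_add star_smult star_mult nrm_nonneg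
      nrm_eq_zero_iff nrm_triangle nrm_smult nrm_mult nrm_star_mult inj_eq\<close>)
qed

text \<open>
  The injection is a linear surjection onto the transported algebra, and images of
  finite-dimensional spaces are finite-dimensional.
\<close>

lemma (in comm_cstar_algebra) transport_fin_dim:
  assumes \<iota>: "inj \<iota>" and "vectorspace.fin_dim (class_ring :: complex ring) A"
  shows "vectorspace.fin_dim (class_ring :: complex ring) (transport \<iota> A)"
proof -
  interpret T: comm_cstar_algebra "transport \<iota> A" by (rule transport_comm_cstar_algebra[OF \<iota>])
  interpret linear_map "class_ring :: complex ring" A "transport \<iota> A" \<iota>
    using \<iota> by (intro linear_map.intro mod_hom.intro mod_hom_axioms.intro cstar_vectorspace
        T.cstar_vectorspace module T.module) (auto simp: LinearCombinations.module_hom_def)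
  show ?thesis
    using rank_nullity_main(2) assms(2) by simp
qed

lemma transport_Cn_in_Ob: "inj \<iota> \<Longrightarrow> transport \<iota> (Cn n) \<in> Ob FdCCstar_PU"
  using Cn_comm_cstar_algebra Cn_fin_dim
    comm_cstar_algebra.transport_comm_cstar_algebra comm_cstar_algebra.transport_fin_dim
  by (fastforce simp: FdCCstar_PU_def)

section \<open>The structure of finite-dimensional commutative \<open>C\<^sup>*\<close>-algebras\<close>

context comm_cstar_algebra
begin

lemma smult_assoc_right:
  "\<lbrakk>x \<in> carrier A; y \<in> carrier A\<rbrakk> \<Longrightarrow> x \<otimes>\<^bsub>A\<^esub> (c \<odot>\<^bsub>A\<^esub> y) = c \<odot>\<^bsub>A\<^esub> (x \<otimes>\<^bsub>A\<^esub> y)"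
  using smult_assoc2[of c y x] by (simp add: m_comm smult_in)

lemma smult_zero_right: "c \<odot>\<^bsub>A\<^esub> \<zero>\<^bsub>A\<^esub> = \<zero>\<^bsub>A\<^esub>"
  by (rule smult_r_null) simp

lemma smult_eq_zero:
  assumes "x \<in> carrier A" "c \<odot>\<^bsub>A\<^esub> x = \<zero>\<^bsub>A\<^esub>"
  shows "c = 0 \<or> x = \<zero>\<^bsub>A\<^esub>"
proof (cases "c = 0")
  case False
  have "x = (inverse c * c) \<odot>\<^bsub>A\<^esub> x" using False assms(1) by (simp add: smult_1_left)
  also have "\<dots> = \<zero>\<^bsub>A\<^esub>" unfolding smult_times_left[OF assms(1)] by (simp add: assms(2) smult_zero_right)
  finally show ?thesis by simp
qed simp

lemma smult_cancel:
  assumes x: "x \<in> carrier A" "x \<noteq> \<zero>\<^bsub>A\<^esub>" and eq: "a \<odot>\<^bsub>A\<^esub> x = b \<odot>\<^bsub>A\<^esub> x"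
  shows "a = b"
proof -
  have "(a - b) \<odot>\<^bsub>A\<^esub> x = a \<odot>\<^bsub>A\<^esub> x \<oplus>\<^bsub>A\<^esub> (- b) \<odot>\<^bsub>A\<^esub> x"
    using smult_plus_left[OF x(1), of a "- b"] by simp
  also have "\<dots> = (b + (- b)) \<odot>\<^bsub>A\<^esub> x"
    unfolding eq by (rule smult_plus_left[OF x(1), symmetric])
  also have "\<dots> = \<zero>\<^bsub>A\<^esub>" using x by (simp add: smult_0_left)
  finally have "a - b = 0 \<or> x = \<zero>\<^bsub>A\<^esub>" by (rule smult_eq_zero[OF x(1)])
  then show ?thesis using x(2) by simp
qed

lemma star_zero: "star A \<zero>\<^bsub>A\<^esub> = \<zero>\<^bsub>A\<^esub>"
  using star_smult[of "\<zero>\<^bsub>A\<^esub>" 0] star_closed[of "\<zero>\<^bsub>A\<^esub>"]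
  by (simp add: smult_0_left)

lemma star_mult_self_eq_zero:
  assumes "x \<in> carrier A" "star A x \<otimes>\<^bsub>A\<^esub> x = \<zero>\<^bsub>A\<^esub>"
  shows "x = \<zero>\<^bsub>A\<^esub>"
proof -
  have "(nrm A x)\<^sup>2 = nrm A \<zero>\<^bsub>A\<^esub>" unfolding assms(2)[symmetric] using nrm_star_mult[OF assms(1)] by (rule sym)
  also have "\<dots> = 0" using nrm_eq_zero_iff[OF M.zero_closed] by (rule iffD2) (rule refl)
  finally have "nrm A x = 0" by (simp only: power_eq_0_iff)
  then show ?thesis by (rule nrm_eq_zero_iff[OF assms(1), THEN iffD1])
qed

text \<open>
  For \<open>h = x\<^sup>* x\<close>, which is self-adjoint, commutativity gives
  \<open>h\<^sup>* h = h\<^sup>2 = (x\<^sup>*)\<^sup>2 x\<^sup>2 = 0\<close>, so the \<open>C\<^sup>*\<close>-identity applies twice.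
\<close>

lemma reduced:
  assumes x: "x \<in> carrier A" and sq: "x \<otimes>\<^bsub>A\<^esub> x = \<zero>\<^bsub>A\<^esub>"
  shows "x = \<zero>\<^bsub>A\<^esub>"
proof -
  define h where "h = star A x \<otimes>\<^bsub>A\<^esub> x"
  note sx = star_closed[OF x]
  have h: "h \<in> carrier A" unfolding h_def using x sx by simp
  have "star A h = h"
    unfolding h_def using x sx by (simp add: star_mult star_star m_comm)
  moreover have "h \<otimes>\<^bsub>A\<^esub> h = (star A x \<otimes>\<^bsub>A\<^esub> star A x) \<otimes>\<^bsub>A\<^esub> (x \<otimes>\<^bsub>A\<^esub> x)"
    unfolding h_def using x sx by (simp add: m_ac)
  ultimately have "star A h \<otimes>\<^bsub>A\<^esub> h = \<zero>\<^bsub>A\<^esub>" using sq sx by simp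
  then have "h = \<zero>\<^bsub>A\<^esub>" by (rule star_mult_self_eq_zero[OF h])
  then show ?thesis unfolding h_def by (rule star_mult_self_eq_zero[OF x])
qed

text \<open>
  The element \<open>p(x) e\<close>, computed by Horner's scheme. For an idempotent \<open>e\<close> it is the value of \<open>p\<close>
  at \<open>x e\<close> in the algebra \<open>A e\<close>, whose unit is \<open>e\<close>.
\<close>

definition poly_act :: "'a \<Rightarrow> 'a \<Rightarrow> complex poly \<Rightarrow> 'a" where
  "poly_act x e p = fold_coeffs (\<lambda>c y. c \<odot>\<^bsub>A\<^esub> e \<oplus>\<^bsub>A\<^esub> x \<otimes>\<^bsub>A\<^esub> y) p \<zero>\<^bsub>A\<^esub>"

context
  fixes x e
  assumes x: "x \<in> carrier A" and e: "e \<in> carrier A"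
begin

lemma poly_act_0: "poly_act x e 0 = \<zero>\<^bsub>A\<^esub>"
  by (simp add: poly_act_def)

lemma poly_act_pCons: "poly_act x e (pCons c p) = c \<odot>\<^bsub>A\<^esub> e \<oplus>\<^bsub>A\<^esub> x \<otimes>\<^bsub>A\<^esub> poly_act x e p"
  using x e by (cases "p = 0 \<and> c = 0") (auto simp: poly_act_def smult_0_left)

lemma poly_act_closed: "poly_act x e p \<in> carrier A"
  by (induction p) (use x e in \<open>auto simp: poly_act_0 poly_act_pCons smult_in\<close>)

lemma poly_act_add: "poly_act x e (p + q) = poly_act x e p \<oplus>\<^bsub>A\<^esub> poly_act x e q"
proof (induction p q rule: poly_induct2)
  case (pCons a p b q)
  then show ?case
    using x e
    by (simp add: poly_act_pCons poly_act_closed smult_in smult_plus_left r_distr M.a_ac)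
qed (simp add: poly_act_0)

lemma poly_act_smult: "poly_act x e (smult c p) = c \<odot>\<^bsub>A\<^esub> poly_act x e p"
  by (induction p)
    (use x e in \<open>simp_all add: poly_act_0 poly_act_pCons poly_act_closed smult_in smult_zero_right
      smult_times_left smult_r_distr smult_assoc_right\<close>)

lemma poly_act_monom: "poly_act x e (monom c i) = c \<odot>\<^bsub>A\<^esub> ((x [^]\<^bsub>A\<^esub> i) \<otimes>\<^bsub>A\<^esub> e)"
proof (induction i)
  case 0
  then show ?case using x e by (simp add: monom_0 poly_act_0 poly_act_pCons smult_in)
next
  case (Suc i)
  have "poly_act x e (monom c (Suc i)) = x \<otimes>\<^bsub>A\<^esub> (c \<odot>\<^bsub>A\<^esub> ((x [^]\<^bsub>A\<^esub> i) \<otimes>\<^bsub>A\<^esub> e))"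
    using x e by (simp add: monom_Suc poly_act_pCons Suc smult_0_left smult_in)
  also have "\<dots> = c \<odot>\<^bsub>A\<^esub> ((x [^]\<^bsub>A\<^esub> Suc i) \<otimes>\<^bsub>A\<^esub> e)"
    using x e by (simp add: smult_assoc_right m_ac)
  finally show ?case .
qed

lemma poly_act_sum:
  "finite I \<Longrightarrow> poly_act x e (\<Sum>i\<in>I. p i) = finsum A (\<lambda>i. poly_act x e (p i)) I"
  by (induction I rule: finite_induct) (auto simp: poly_act_0 poly_act_add poly_act_closed)

lemma poly_act_mult_linear:
  "poly_act x e ([:-a, 1:] * q) = (- a) \<odot>\<^bsub>A\<^esub> poly_act x e q \<oplus>\<^bsub>A\<^esub> x \<otimes>\<^bsub>A\<^esub> poly_act x e q"
proof -
  have "[:-a, 1:] * q = smult (- a) q + pCons 0 q" by simp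
  then show ?thesis
    using x e by (simp only: poly_act_add poly_act_smult poly_act_pCons)
      (simp add: smult_0_left poly_act_closed)
qed

lemma poly_act_idem:
  assumes "e \<otimes>\<^bsub>A\<^esub> e = e"
  shows "e \<otimes>\<^bsub>A\<^esub> poly_act x e p = poly_act x e p"
proof (induction p)
  case (pCons c p)
  have "e \<otimes>\<^bsub>A\<^esub> (x \<otimes>\<^bsub>A\<^esub> poly_act x e p) = x \<otimes>\<^bsub>A\<^esub> (e \<otimes>\<^bsub>A\<^esub> poly_act x e p)"
    using x e by (simp add: m_ac poly_act_closed)
  then show ?case
    using x e assms
    by (simp add: poly_act_pCons r_distr smult_in smult_assoc_right poly_act_closed pCons.IH)
qed (use e in \<open>simp add: poly_act_0\<close>)

lemma poly_act_eigenvector: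
  assumes y: "y \<in> carrier A" and ey: "e \<otimes>\<^bsub>A\<^esub> y = y" and xy: "x \<otimes>\<^bsub>A\<^esub> y = a \<odot>\<^bsub>A\<^esub> y"
  shows "poly_act x e p \<otimes>\<^bsub>A\<^esub> y = poly p a \<odot>\<^bsub>A\<^esub> y"
proof (induction p)
  case (pCons c p)
  have "(x \<otimes>\<^bsub>A\<^esub> poly_act x e p) \<otimes>\<^bsub>A\<^esub> y = poly_act x e p \<otimes>\<^bsub>A\<^esub> (x \<otimes>\<^bsub>A\<^esub> y)"
    using x y by (simp add: m_ac poly_act_closed)
  also have "\<dots> = (a * poly p a) \<odot>\<^bsub>A\<^esub> y"
    using y by (simp add: xy smult_assoc_right poly_act_closed pCons.IH smult_times_left)
  finally show ?case
    using x e y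
    by (simp add: poly_act_pCons l_distr smult_in smult_assoc2 ey poly_act_closed smult_plus_left)
qed (use y in \<open>simp add: poly_act_0 smult_0_left\<close>)

end

end

locale fin_dim_comm_cstar_algebra = comm_cstar_algebra +
  assumes finite_dimensional: "vectorspace.fin_dim (class_ring :: complex ring) A"
begin

lemma lin_indpt_finite:
  assumes "S \<subseteq> carrier A" "\<not> lin_dep S"
  shows "finite S"
  using vectorspace.fin_dim_li_fin[OF cstar_vectorspace finite_dimensional assms(2,1)] .

text \<open>
  In finite dimension the elements \<open>x\<^sup>i e\<close> satisfy a linear relation, whose coefficients are those of
  the polynomial. Linear dependence is a property of sets, so a coincidence between two
  of these elements is a case of its own.
\<close>

lemma annihilating_poly:
  assumes x: "x \<in> carrier A" and e: "e \<in> carrier A"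
  shows "\<exists>p. p \<noteq> 0 \<and> poly_act x e p = \<zero>\<^bsub>A\<^esub>"
proof -
  define u where "u i = (x [^]\<^bsub>A\<^esub> i) \<otimes>\<^bsub>A\<^esub> e" for i :: nat
  have u: "u i \<in> carrier A" for i unfolding u_def using x e by simp
  note monom = poly_act_monom[OF x e, folded u_def]
  show ?thesis
  proof (cases "inj u")
    case True
    then have "infinite (range u)" by (rule range_inj_infinite)
    then have "lin_dep (range u)" using lin_indpt_finite[of "range u"] u by auto
    then obtain U a v where U: "finite U" "U \<subseteq> range u" and lc: "lincomb a U = \<zero>\<^bsub>A\<^esub>"
      and v: "v \<in> U" "a v \<noteq> 0"
      unfolding lin_dep_def by auto
    obtain I where I: "U = u ` I" using U(2) by (auto simp: subset_image_iff)
    have inj: "inj_on u I" using True by (rule inj_on_subset) simp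
    have finI: "finite I" using U(1) inj unfolding I by (simp add: finite_image_iff)
    define p where "p = (\<Sum>i\<in>I. monom (a (u i)) i)"
    have "poly_act x e p = finsum A (\<lambda>i. a (u i) \<odot>\<^bsub>A\<^esub> u i) I"
      unfolding p_def poly_act_sum[OF x e finI] monom ..
    also have "\<dots> = lincomb a U"
      unfolding lincomb_def I by (rule finsum_reindex[symmetric, OF _ inj]) (auto simp: u smult_in)
    finally have p0: "poly_act x e p = \<zero>\<^bsub>A\<^esub>" using lc by simp
    obtain j where j: "j \<in> I" "v = u j" using v(1) I by auto
    have "coeff p j = (\<Sum>i\<in>I. if i = j then a (u i) else 0)"
      unfolding p_def by (simp add: coeff_sum)
    also have "\<dots> = a v" using finI j by simp
    finally have "p \<noteq> 0" using v(2) by auto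
    then show ?thesis using p0 by blast
  next
    case False
    then obtain i j where ij: "i \<noteq> j" "u i = u j" by (auto simp: inj_def)
    \<comment> \<open>If \<open>x\<^sup>i e = x\<^sup>j e\<close>, then \<open>X\<^sup>j - X\<^sup>i\<close> annihilates.\<close>
    let ?p = "monom 1 j + monom (-1) i :: complex poly"
    have "poly_act x e ?p = 1 \<odot>\<^bsub>A\<^esub> u i \<oplus>\<^bsub>A\<^esub> (-1) \<odot>\<^bsub>A\<^esub> u i"
      using ij(2) by (simp add: poly_act_add[OF x e] monom)
    also have "\<dots> = (1 + -1) \<odot>\<^bsub>A\<^esub> u i"
      by (rule smult_plus_left[OF u, symmetric])
    also have "\<dots> = \<zero>\<^bsub>A\<^esub>" by (simp add: smult_0_left u)
    finally have p0: "poly_act x e ?p = \<zero>\<^bsub>A\<^esub>" .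
    have "coeff ?p j = 1" using ij(1) by simp
    then have "?p \<noteq> 0" by (metis coeff_0 zero_neq_one)
    then show ?thesis using p0 by blast
  qed
qed

text \<open>
  The step that replaces a spectral theorem. Minimality of the degree makes the cofactor \<open>q\<close> of a root
  act nontrivially, and absence of nilpotents turns the resulting eigenvector into a multiple of an
  idempotent.
\<close>

lemma eigen_idempotent:
  assumes x: "x \<in> carrier A" and e: "e \<in> carrier A" and idem: "e \<otimes>\<^bsub>A\<^esub> e = e" and ne: "e \<noteq> \<zero>\<^bsub>A\<^esub>"
  obtains f a where "f \<in> carrier A" "f \<noteq> \<zero>\<^bsub>A\<^esub>" "f \<otimes>\<^bsub>A\<^esub> f = f" "e \<otimes>\<^bsub>A\<^esub> f = f" "x \<otimes>\<^bsub>A\<^esub> f = a \<odot>\<^bsub>A\<^esub> f"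
proof -
  obtain p where p: "p \<noteq> 0" "poly_act x e p = \<zero>\<^bsub>A\<^esub>"
    and least: "\<And>q. \<lbrakk>q \<noteq> 0; poly_act x e q = \<zero>\<^bsub>A\<^esub>\<rbrakk> \<Longrightarrow> degree p \<le> degree q"
    using ex_has_least_nat[of "\<lambda>p. p \<noteq> 0 \<and> poly_act x e p = \<zero>\<^bsub>A\<^esub>" _ degree]
      annihilating_poly[OF x e] by metis
  have "degree p \<noteq> 0"
  proof
    assume "degree p = 0"
    then obtain c where c: "p = [:c:]" by (meson degree_eq_zeroE)
    then have "c \<odot>\<^bsub>A\<^esub> e = \<zero>\<^bsub>A\<^esub>"
      using p(2) x e by (simp add: poly_act_pCons poly_act_0 smult_in)
    then show False using smult_eq_zero[OF e] ne p(1) c by auto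
  qed
  then obtain a where "poly p a = 0"
    using fundamental_theorem_of_algebra[of p] by (auto simp: constant_degree)
  then obtain q where q: "p = [:-a, 1:] * q" by (auto simp: poly_eq_0_iff_dvd)
  have q0: "q \<noteq> 0" using p(1) q by auto
  have "degree p = Suc (degree q)" unfolding q using q0 by (subst degree_mult_eq) auto
  define y where "y = poly_act x e q"
  have y: "y \<in> carrier A" unfolding y_def by (rule poly_act_closed[OF x e])
  have y0: "y \<noteq> \<zero>\<^bsub>A\<^esub>" using least[OF q0] \<open>degree p = _\<close> unfolding y_def by auto
  have ey: "e \<otimes>\<^bsub>A\<^esub> y = y" unfolding y_def by (rule poly_act_idem[OF x e idem])
  have xy: "x \<otimes>\<^bsub>A\<^esub> y = a \<odot>\<^bsub>A\<^esub> y"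
  proof -
    have "x \<otimes>\<^bsub>A\<^esub> y = (a \<odot>\<^bsub>A\<^esub> y \<oplus>\<^bsub>A\<^esub> (- a) \<odot>\<^bsub>A\<^esub> y) \<oplus>\<^bsub>A\<^esub> x \<otimes>\<^bsub>A\<^esub> y"
      using x y smult_plus_left[OF y, of a "- a"] by (simp add: smult_0_left)
    also have "\<dots> = a \<odot>\<^bsub>A\<^esub> y \<oplus>\<^bsub>A\<^esub> ((- a) \<odot>\<^bsub>A\<^esub> y \<oplus>\<^bsub>A\<^esub> x \<otimes>\<^bsub>A\<^esub> y)"
      using x y by (simp add: M.a_assoc smult_in)
    also have "(- a) \<odot>\<^bsub>A\<^esub> y \<oplus>\<^bsub>A\<^esub> x \<otimes>\<^bsub>A\<^esub> y = \<zero>\<^bsub>A\<^esub>"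
      using p(2) unfolding q poly_act_mult_linear[OF x e] y_def .
    finally show ?thesis using y by (simp add: smult_in)
  qed
  define c where "c = poly q a"
  have yy: "y \<otimes>\<^bsub>A\<^esub> y = c \<odot>\<^bsub>A\<^esub> y"
    using poly_act_eigenvector[OF x e y ey xy, of q] unfolding y_def c_def .
  have c0: "c \<noteq> 0"
  proof
    assume "c = 0"
    then have "y \<otimes>\<^bsub>A\<^esub> y = \<zero>\<^bsub>A\<^esub>" using yy y by (simp add: smult_0_left)
    then show False using reduced[OF y] y0 by simp
  qed
  define f where "f = inverse c \<odot>\<^bsub>A\<^esub> y"
  show thesis
  proof
    show "f \<in> carrier A" unfolding f_def by (rule smult_in[OF y])
    show "f \<noteq> \<zero>\<^bsub>A\<^esub>" unfolding f_def using smult_eq_zero[OF y, of "inverse c"] c0 y0 by auto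
    show "e \<otimes>\<^bsub>A\<^esub> f = f" unfolding f_def using e y ey by (simp add: smult_assoc_right)
    show "x \<otimes>\<^bsub>A\<^esub> f = a \<odot>\<^bsub>A\<^esub> f"
      unfolding f_def using x y xy
      by (simp add: smult_assoc_right mult.commute flip: smult_times_left)
    have "f \<otimes>\<^bsub>A\<^esub> f = (inverse c * inverse c * c) \<odot>\<^bsub>A\<^esub> y"
      unfolding f_def using y by (simp only: smult_assoc_right smult_assoc2 smult_in yy smult_times_left)
        (simp add: smult_assoc2 smult_in yy)
    also have "inverse c * inverse c * c = inverse c" using c0 by simp
    finally show "f \<otimes>\<^bsub>A\<^esub> f = f" unfolding f_def .
  qed
qed

text \<open>
  The nonzero idempotents \<open>f\<close> with \<open>A f = \<complex> f\<close>. They turn out to be the minimal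
  idempotents, but it is the action by scalars that yields coordinates.
\<close>

definition atoms :: "'a set" where
  "atoms = {f \<in> carrier A. f \<noteq> \<zero>\<^bsub>A\<^esub> \<and> f \<otimes>\<^bsub>A\<^esub> f = f \<and> (\<forall>x\<in>carrier A. \<exists>a. x \<otimes>\<^bsub>A\<^esub> f = a \<odot>\<^bsub>A\<^esub> f)}"

lemma
  assumes "f \<in> atoms"
  shows atom_closed: "f \<in> carrier A" and atom_nonzero: "f \<noteq> \<zero>\<^bsub>A\<^esub>" and atom_idem: "f \<otimes>\<^bsub>A\<^esub> f = f"
    and atom_scalar: "x \<in> carrier A \<Longrightarrow> \<exists>a. x \<otimes>\<^bsub>A\<^esub> f = a \<odot>\<^bsub>A\<^esub> f"
  using assms by (auto simp: atoms_def)

text \<open>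
  Being an eigenvector of \<open>x\<close> passes from an idempotent \<open>f\<close> to every idempotent below it. So
  the elements of a finite generating set can be treated one after the other, and the
  elements acting on the last idempotent by a scalar form a submodule, hence everything.
\<close>

lemma ex_atom_below:
  assumes e: "e \<in> carrier A" and idem: "e \<otimes>\<^bsub>A\<^esub> e = e" and ne: "e \<noteq> \<zero>\<^bsub>A\<^esub>"
  shows "\<exists>f\<in>atoms. e \<otimes>\<^bsub>A\<^esub> f = f"
proof -
  obtain S where S: "finite S" "S \<subseteq> carrier A" "span S = carrier A"
    using finite_dimensional unfolding vectorspace.fin_dim_def[OF cstar_vectorspace] by blast
  have "\<exists>f\<in>carrier A. f \<noteq> \<zero>\<^bsub>A\<^esub> \<and> f \<otimes>\<^bsub>A\<^esub> f = f \<and> e \<otimes>\<^bsub>A\<^esub> f = f \<and> (\<forall>x\<in>S. \<exists>a. x \<otimes>\<^bsub>A\<^esub> f = a \<odot>\<^bsub>A\<^esub> f)"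
    using S(1,2)
  proof (induction S rule: finite_induct)
    case empty
    then show ?case using e idem ne by blast
  next
    case (insert x S)
    then obtain f where f: "f \<in> carrier A" "f \<noteq> \<zero>\<^bsub>A\<^esub>" "f \<otimes>\<^bsub>A\<^esub> f = f" "e \<otimes>\<^bsub>A\<^esub> f = f"
      and fS: "\<And>y. y \<in> S \<Longrightarrow> \<exists>a. y \<otimes>\<^bsub>A\<^esub> f = a \<odot>\<^bsub>A\<^esub> f" by auto
    have x: "x \<in> carrier A" using insert.prems by simp
    obtain g a where g: "g \<in> carrier A" "g \<noteq> \<zero>\<^bsub>A\<^esub>" "g \<otimes>\<^bsub>A\<^esub> g = g" "f \<otimes>\<^bsub>A\<^esub> g = g" "x \<otimes>\<^bsub>A\<^esub> g = a \<odot>\<^bsub>A\<^esub> g"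
      using eigen_idempotent[OF x f(1,3,2)] by blast
    have "e \<otimes>\<^bsub>A\<^esub> g = (e \<otimes>\<^bsub>A\<^esub> f) \<otimes>\<^bsub>A\<^esub> g" using e f(1) g(1,4) by (simp add: m_assoc)
    then have "e \<otimes>\<^bsub>A\<^esub> g = g" using f(4) g(4) by simp
    moreover have "\<exists>b. y \<otimes>\<^bsub>A\<^esub> g = b \<odot>\<^bsub>A\<^esub> g" if y: "y \<in> S" for y
    proof -
      obtain b where b: "y \<otimes>\<^bsub>A\<^esub> f = b \<odot>\<^bsub>A\<^esub> f" using fS[OF y] by blast
      have yc: "y \<in> carrier A" using y insert.prems by auto
      have "y \<otimes>\<^bsub>A\<^esub> g = (y \<otimes>\<^bsub>A\<^esub> f) \<otimes>\<^bsub>A\<^esub> g" using yc f(1) g(1,4) by (simp add: m_assoc)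
      also have "\<dots> = b \<odot>\<^bsub>A\<^esub> g" unfolding b using f(1) g(1,4) by (simp add: smult_assoc2)
      finally show ?thesis by blast
    qed
    ultimately show ?case using g by (intro bexI[of _ g]) auto
  qed
  then obtain f where f: "f \<in> carrier A" "f \<noteq> \<zero>\<^bsub>A\<^esub>" "f \<otimes>\<^bsub>A\<^esub> f = f" "e \<otimes>\<^bsub>A\<^esub> f = f"
    and fS: "\<And>x. x \<in> S \<Longrightarrow> \<exists>a. x \<otimes>\<^bsub>A\<^esub> f = a \<odot>\<^bsub>A\<^esub> f" by auto
  let ?N = "{x \<in> carrier A. \<exists>a. x \<otimes>\<^bsub>A\<^esub> f = a \<odot>\<^bsub>A\<^esub> f}"
  have "submodule class_ring ?N A"
  proof (intro submodule.intro module)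
    show "?N \<subseteq> carrier A" by blast
    show "\<zero>\<^bsub>A\<^esub> \<in> ?N" using f(1) smult_0_left[OF f(1)] by (auto intro!: exI[of _ 0])
    show "v \<oplus>\<^bsub>A\<^esub> w \<in> ?N" if vw: "v \<in> ?N" "w \<in> ?N" for v w
    proof -
      from vw obtain a b where "v \<otimes>\<^bsub>A\<^esub> f = a \<odot>\<^bsub>A\<^esub> f" "w \<otimes>\<^bsub>A\<^esub> f = b \<odot>\<^bsub>A\<^esub> f" by auto
      then have "(v \<oplus>\<^bsub>A\<^esub> w) \<otimes>\<^bsub>A\<^esub> f = (a + b) \<odot>\<^bsub>A\<^esub> f"
        using vw f(1) by (simp add: l_distr smult_plus_left)
      then show ?thesis using vw by auto
    qed
    show "c \<odot>\<^bsub>A\<^esub> v \<in> ?N" if v: "v \<in> ?N" for c v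
    proof -
      from v obtain a where "v \<otimes>\<^bsub>A\<^esub> f = a \<odot>\<^bsub>A\<^esub> f" by auto
      then have "(c \<odot>\<^bsub>A\<^esub> v) \<otimes>\<^bsub>A\<^esub> f = (c * a) \<odot>\<^bsub>A\<^esub> f"
        using v f(1) by (simp add: smult_assoc2 smult_times_left)
      then show ?thesis using v by (auto simp: smult_in)
    qed
  qed
  moreover have "S \<subseteq> ?N" using S(2) fS by auto
  ultimately have "carrier A \<subseteq> ?N"
    using span_is_subset S(3) by blast
  then have "f \<in> atoms" using f unfolding atoms_def by auto
  then show ?thesis using f(4) by blast
qed

text \<open>
  If \<open>f g = a g\<close>, then \<open>f\<^sup>2 = f\<close> gives \<open>a\<^sup>2 = a\<close>, so \<open>a\<close> is \<open>0\<close> or \<open>1\<close>. By symmetry a nonzero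
  product of two atoms equals both of them.
\<close>

lemma atom_mult_atom:
  assumes f: "f \<in> atoms" and g: "g \<in> atoms" and ne: "f \<otimes>\<^bsub>A\<^esub> g \<noteq> \<zero>\<^bsub>A\<^esub>"
  shows "f \<otimes>\<^bsub>A\<^esub> g = g"
proof -
  note fc = atom_closed[OF f] and gc = atom_closed[OF g]
  obtain a where a: "f \<otimes>\<^bsub>A\<^esub> g = a \<odot>\<^bsub>A\<^esub> g" using atom_scalar[OF g fc] by blast
  have "(a * a) \<odot>\<^bsub>A\<^esub> g = f \<otimes>\<^bsub>A\<^esub> (f \<otimes>\<^bsub>A\<^esub> g)"
    using fc gc by (simp add: a smult_assoc_right smult_times_left)
  also have "\<dots> = (f \<otimes>\<^bsub>A\<^esub> f) \<otimes>\<^bsub>A\<^esub> g" using fc gc by (simp add: m_assoc)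
  also have "\<dots> = a \<odot>\<^bsub>A\<^esub> g" by (simp add: atom_idem[OF f] a)
  finally have "a * a = a" by (rule smult_cancel[OF gc atom_nonzero[OF g]])
  moreover have "a \<noteq> 0" using ne a gc by (auto simp: smult_0_left)
  ultimately show ?thesis using a gc by (simp add: smult_1_left)
qed

lemma atoms_orthogonal:
  assumes f: "f \<in> atoms" and g: "g \<in> atoms" and "f \<noteq> g"
  shows "f \<otimes>\<^bsub>A\<^esub> g = \<zero>\<^bsub>A\<^esub>"
  using atom_mult_atom[OF f g] atom_mult_atom[OF g f] m_comm[OF atom_closed[OF f] atom_closed[OF g]]
    assms(3) by metis

text \<open>
  Multiplication by an atom reads off its coefficient in a linear combination. This one computation
  gives linear independence, the sum of all atoms, and the coordinates of the isomorphism.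
\<close>

lemma atom_mult_sum:
  assumes U: "finite U" "U \<subseteq> atoms" and f: "f \<in> U"
  shows "f \<otimes>\<^bsub>A\<^esub> finsum A (\<lambda>u. c u \<odot>\<^bsub>A\<^esub> u) U = c f \<odot>\<^bsub>A\<^esub> f"
proof -
  have Uc: "u \<in> carrier A" if "u \<in> U" for u using that U(2) atom_closed by blast
  note fc = Uc[OF f]
  have "f \<otimes>\<^bsub>A\<^esub> finsum A (\<lambda>u. c u \<odot>\<^bsub>A\<^esub> u) U = finsum A (\<lambda>u. f \<otimes>\<^bsub>A\<^esub> (c u \<odot>\<^bsub>A\<^esub> u)) U"
    using U(1) fc by (rule finsum_rdistr) (auto simp: Uc smult_in)
  also have "\<dots> = finsum A (\<lambda>u. if f = u then c u \<odot>\<^bsub>A\<^esub> u else \<zero>\<^bsub>A\<^esub>) U"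
  proof (rule finsum_cong')
    fix u assume u: "u \<in> U"
    have "f \<otimes>\<^bsub>A\<^esub> u = (if f = u then u else \<zero>\<^bsub>A\<^esub>)"
      using atoms_orthogonal[of f u] atom_idem[of f] f u U(2) by auto
    then show "f \<otimes>\<^bsub>A\<^esub> (c u \<odot>\<^bsub>A\<^esub> u) = (if f = u then c u \<odot>\<^bsub>A\<^esub> u else \<zero>\<^bsub>A\<^esub>)"
      using fc Uc[OF u] by (simp add: smult_assoc_right smult_zero_right)
  qed (auto simp: Uc smult_in)
  also have "\<dots> = c f \<odot>\<^bsub>A\<^esub> f"
    using f U(1) by (rule add.finprod_singleton) (auto simp: Uc smult_in)
  finally show ?thesis .
qed

lemma finite_atoms: "finite atoms"
proof (rule lin_indpt_finite)
  show "atoms \<subseteq> carrier A" using atom_closed by blast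
  show "\<not> lin_dep atoms"
  proof
    assume "lin_dep atoms"
    then obtain U a f where U: "finite U" "U \<subseteq> atoms" and lc: "lincomb a U = \<zero>\<^bsub>A\<^esub>"
      and f: "f \<in> U" "a f \<noteq> 0"
      unfolding lin_dep_def by auto
    have fA: "f \<in> atoms" using f U by auto
    have "a f \<odot>\<^bsub>A\<^esub> f = f \<otimes>\<^bsub>A\<^esub> \<zero>\<^bsub>A\<^esub>"
      using atom_mult_sum[OF U f(1), of a] lc unfolding lincomb_def by simp
    then show False
      using smult_eq_zero[OF atom_closed[OF fA], of "a f"] f(2) atom_nonzero[OF fA] atom_closed[OF fA]
      by simp
  qed
qed

text \<open>
  The complement of the sum is idempotent and annihilated by every atom. If it were
  nonzero, it would lie above some atom.
\<close>

lemma sum_atoms: "finsum A (\<lambda>u. u) atoms = \<one>\<^bsub>A\<^esub>"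
proof -
  define s where "s = finsum A (\<lambda>u. u) atoms"
  have s: "s \<in> carrier A" unfolding s_def by (rule finsum_closed) (auto simp: atom_closed)
  have s1: "s = finsum A (\<lambda>u. 1 \<odot>\<^bsub>A\<^esub> u) atoms"
    unfolding s_def by (rule finsum_cong') (auto simp: atom_closed smult_1_left smult_in)
  have fs: "f \<otimes>\<^bsub>A\<^esub> s = f" if "f \<in> atoms" for f
    using atom_mult_sum[OF finite_atoms subset_refl that, of "\<lambda>_. 1"] atom_closed[OF that]
    unfolding s1 by (simp add: smult_1_left)
  have "s \<otimes>\<^bsub>A\<^esub> s = finsum A (\<lambda>u. u \<otimes>\<^bsub>A\<^esub> s) atoms"
    unfolding s_def by (rule finsum_ldistr[OF finite_atoms]) (use s s_def atom_closed in auto)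
  also have "\<dots> = s"
    unfolding s_def by (rule finsum_cong') (use fs[unfolded s_def] in \<open>auto simp: atom_closed\<close>)
  finally have ss: "s \<otimes>\<^bsub>A\<^esub> s = s" .
  define e where "e = \<one>\<^bsub>A\<^esub> \<ominus>\<^bsub>A\<^esub> s"
  have e: "e \<in> carrier A" unfolding e_def using s by simp
  have xe: "x \<otimes>\<^bsub>A\<^esub> e = x \<ominus>\<^bsub>A\<^esub> x \<otimes>\<^bsub>A\<^esub> s" if "x \<in> carrier A" for x
    unfolding e_def a_minus_def using that s by (simp add: r_distr r_minus)
  have "s \<otimes>\<^bsub>A\<^esub> e = \<zero>\<^bsub>A\<^esub>" using xe[OF s] ss s by (simp add: a_minus_def M.r_neg)
  then have "e \<otimes>\<^bsub>A\<^esub> e = e"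
    using xe[OF e] e s by (simp add: m_comm[of e s] a_minus_def)
  moreover have "\<not> (\<exists>f\<in>atoms. e \<otimes>\<^bsub>A\<^esub> f = f)"
  proof
    assume "\<exists>f\<in>atoms. e \<otimes>\<^bsub>A\<^esub> f = f"
    then obtain f where f: "f \<in> atoms" "e \<otimes>\<^bsub>A\<^esub> f = f" by blast
    note fc = atom_closed[OF f(1)]
    have "f = f \<otimes>\<^bsub>A\<^esub> e" using f(2) fc e by (simp add: m_comm)
    also have "\<dots> = \<zero>\<^bsub>A\<^esub>" using xe[OF fc] fs[OF f(1)] fc by (simp add: a_minus_def M.r_neg)
    finally show False using atom_nonzero[OF f(1)] by simp
  qed
  ultimately have "e = \<zero>\<^bsub>A\<^esub>" using ex_atom_below[OF e] by blast
  then have "s = \<one>\<^bsub>A\<^esub>"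
    using s unfolding e_def by simp
  then show ?thesis by (simp add: s_def)
qed

lemma eq_if_atom_mult_eq:
  assumes x: "x \<in> carrier A" and y: "y \<in> carrier A"
    and eq: "\<And>f. f \<in> atoms \<Longrightarrow> f \<otimes>\<^bsub>A\<^esub> x = f \<otimes>\<^bsub>A\<^esub> y"
  shows "x = y"
proof -
  have expand: "z = finsum A (\<lambda>f. f \<otimes>\<^bsub>A\<^esub> z) atoms" if "z \<in> carrier A" for z
    using finsum_ldistr[OF finite_atoms that, of "\<lambda>u. u"] sum_atoms that atom_closed by auto
  have "finsum A (\<lambda>f. f \<otimes>\<^bsub>A\<^esub> x) atoms = finsum A (\<lambda>f. f \<otimes>\<^bsub>A\<^esub> y) atoms"
    by (rule finsum_cong') (use eq y atom_closed in auto)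
  then show ?thesis using expand[OF x] expand[OF y] by simp
qed

text \<open>
  The star maps atoms to atoms. Were the atoms \<open>f\<^sup>*\<close> and \<open>f\<close> different, they would be orthogonal,
  and \<open>f\<^sup>* f = 0\<close> contradicts \<open>f \<noteq> 0\<close>.
\<close>

lemma star_atom:
  assumes f: "f \<in> atoms"
  shows "star A f = f"
proof (rule ccontr)
  note fc = atom_closed[OF f]
  note sf = star_closed[OF fc]
  assume "star A f \<noteq> f"
  moreover have "star A f \<in> atoms"
    unfolding atoms_def
  proof (intro CollectI conjI ballI)
    show "star A f \<in> carrier A" by (rule sf)
    show "star A f \<noteq> \<zero>\<^bsub>A\<^esub>"
      using star_star[OF fc] star_zero atom_nonzero[OF f] by auto
    show "star A f \<otimes>\<^bsub>A\<^esub> star A f = star A f"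
      using star_mult[OF fc fc] atom_idem[OF f] by simp
    fix x assume x: "x \<in> carrier A"
    obtain a where a: "star A x \<otimes>\<^bsub>A\<^esub> f = a \<odot>\<^bsub>A\<^esub> f"
      using atom_scalar[OF f star_closed[OF x]] by blast
    have "x \<otimes>\<^bsub>A\<^esub> star A f = star A (star A x \<otimes>\<^bsub>A\<^esub> f)"
      using x fc by (simp add: star_mult star_closed star_star m_comm)
    also have "\<dots> = cnj a \<odot>\<^bsub>A\<^esub> star A f" unfolding a by (rule star_smult[OF fc])
    finally show "\<exists>a. x \<otimes>\<^bsub>A\<^esub> star A f = a \<odot>\<^bsub>A\<^esub> star A f" by blast
  qed
  ultimately have "star A f \<otimes>\<^bsub>A\<^esub> f = \<zero>\<^bsub>A\<^esub>" using atoms_orthogonal f by blast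
  then show False using star_mult_self_eq_zero[OF fc] atom_nonzero[OF f] by simp
qed

text \<open>
  A coordinate vector is sent to the corresponding combination of atoms. All the equations are
  checked after multiplication by an arbitrary atom, where they become equations between scalars.
\<close>

theorem ex_star_iso_Cn:
  "\<exists>n \<psi>. star_hom (Cn n) A \<psi> \<and> bij_betw \<psi> (carrier (Cn n)) (carrier A)"
proof -
  obtain n and p :: "nat \<Rightarrow> 'a" where p: "bij_betw p {..<n} atoms"
    using ex_bij_betw_nat_finite[OF finite_atoms] by (auto simp: atLeast0LessThan)
  have inj: "inj_on p {..<n}" and im: "p ` {..<n} = atoms" using p by (auto simp: bij_betw_def)
  have pA: "p i \<in> atoms" if "i < n" for i using im that by auto
  note pc = atom_closed[OF pA]
  have eqI: "x = y"
    if "x \<in> carrier A" "y \<in> carrier A" "\<And>i. i < n \<Longrightarrow> p i \<otimes>\<^bsub>A\<^esub> x = p i \<otimes>\<^bsub>A\<^esub> y" for x y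
  proof (rule eq_if_atom_mult_eq[OF that(1,2)])
    fix f assume "f \<in> atoms"
    then obtain i where "i < n" "f = p i" using im by auto
    then show "f \<otimes>\<^bsub>A\<^esub> x = f \<otimes>\<^bsub>A\<^esub> y" using that(3) by simp
  qed
  define \<psi> where "\<psi> v = finsum A (\<lambda>f. v (inv_into {..<n} p f) \<odot>\<^bsub>A\<^esub> f) atoms" for v
  have \<psi>: "\<psi> v \<in> carrier A" for v
    unfolding \<psi>_def by (rule finsum_closed) (auto simp: atom_closed smult_in)
  have p\<psi>: "p i \<otimes>\<^bsub>A\<^esub> \<psi> v = v i \<odot>\<^bsub>A\<^esub> p i" if "i < n" for i v
    using atom_mult_sum[OF finite_atoms subset_refl pA[OF that], of "\<lambda>f. v (inv_into {..<n} p f)"]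
      inv_into_f_f[OF inj, of i] that unfolding \<psi>_def by simp
  have "star_hom (Cn n) A \<psi>"
    unfolding star_hom_def
  proof (intro conjI ballI allI)
    fix v w :: "nat \<Rightarrow> complex" and c
    show "\<psi> (v \<oplus>\<^bsub>Cn n\<^esub> w) = \<psi> v \<oplus>\<^bsub>A\<^esub> \<psi> w"
      by (rule eqI) (simp_all add: \<psi> p\<psi> pc r_distr smult_plus_left)
    show "\<psi> (v \<otimes>\<^bsub>Cn n\<^esub> w) = \<psi> v \<otimes>\<^bsub>A\<^esub> \<psi> w"
    proof (rule eqI)
      fix i assume i: "i < n"
      have "p i \<otimes>\<^bsub>A\<^esub> (\<psi> v \<otimes>\<^bsub>A\<^esub> \<psi> w) = (p i \<otimes>\<^bsub>A\<^esub> \<psi> v) \<otimes>\<^bsub>A\<^esub> \<psi> w"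
        using pc[OF i] by (simp add: m_assoc \<psi>)
      also have "\<dots> = (v i * w i) \<odot>\<^bsub>A\<^esub> p i"
        using pc[OF i] i by (simp add: p\<psi> smult_assoc2 \<psi> smult_times_left)
      finally show "p i \<otimes>\<^bsub>A\<^esub> \<psi> (v \<otimes>\<^bsub>Cn n\<^esub> w) = p i \<otimes>\<^bsub>A\<^esub> (\<psi> v \<otimes>\<^bsub>A\<^esub> \<psi> w)"
        using i by (simp add: p\<psi>)
    qed (simp_all add: \<psi>)
    show "\<psi> (c \<odot>\<^bsub>Cn n\<^esub> v) = c \<odot>\<^bsub>A\<^esub> \<psi> v"
      by (rule eqI) (simp_all add: \<psi> p\<psi> pc smult_in smult_assoc_right smult_times_left)
    show "\<psi> (star (Cn n) v) = star A (\<psi> v)"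
    proof (rule eqI)
      fix i assume i: "i < n"
      have "p i \<otimes>\<^bsub>A\<^esub> star A (\<psi> v) = star A (\<psi> v \<otimes>\<^bsub>A\<^esub> p i)"
        using pc[OF i] by (simp add: star_mult \<psi> star_atom[OF pA[OF i]])
      also have "\<psi> v \<otimes>\<^bsub>A\<^esub> p i = v i \<odot>\<^bsub>A\<^esub> p i"
        using m_comm[OF \<psi> pc[OF i]] p\<psi>[OF i] by simp
      also have "star A \<dots> = cnj (v i) \<odot>\<^bsub>A\<^esub> p i"
        using star_smult[OF pc[OF i]] star_atom[OF pA[OF i]] by simp
      finally show "p i \<otimes>\<^bsub>A\<^esub> \<psi> (star (Cn n) v) = p i \<otimes>\<^bsub>A\<^esub> star A (\<psi> v)"
        using i by (simp add: p\<psi>)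
    qed (simp_all add: \<psi> star_closed)
    show "\<psi> \<one>\<^bsub>Cn n\<^esub> = \<one>\<^bsub>A\<^esub>"
      by (rule eqI) (simp_all add: \<psi> p\<psi> pc smult_1_left)
  qed (simp add: \<psi>)
  moreover have "bij_betw \<psi> (carrier (Cn n)) (carrier A)"
    unfolding bij_betw_def
  proof
    show "inj_on \<psi> (carrier (Cn n))"
    proof (rule inj_onI)
      fix v w assume vw: "v \<in> carrier (Cn n)" "w \<in> carrier (Cn n)" and eq: "\<psi> v = \<psi> w"
      have "v i = w i" if i: "i < n" for i
        using p\<psi>[OF i, of v] p\<psi>[OF i, of w] eq
        by (intro smult_cancel[OF pc[OF i] atom_nonzero[OF pA[OF i]]]) simp
      then show "v = w" using Cn_eq_iff[OF vw] by simp
    qed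
    have "x \<in> \<psi> ` carrier (Cn n)" if x: "x \<in> carrier A" for x
    proof -
      have "\<exists>v. \<forall>i<n. x \<otimes>\<^bsub>A\<^esub> p i = v i \<odot>\<^bsub>A\<^esub> p i"
        using atom_scalar[OF pA x] by metis
      then obtain v where v: "\<And>i. i < n \<Longrightarrow> x \<otimes>\<^bsub>A\<^esub> p i = v i \<odot>\<^bsub>A\<^esub> p i" by blast
      have "x = \<psi> (restrict v {..<n})"
        by (rule eqI) (simp_all add: x \<psi> p\<psi> v[symmetric] m_comm[OF x] pc)
      then show ?thesis by auto
    qed
    then show "\<psi> ` carrier (Cn n) = carrier A" using \<psi> by auto
  qed
  ultimately show ?thesis by blast
qed

end

section \<open>The Kleisli category of the distribution monad\<close>

lemma Dist_finite:
  assumes "finite X"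
  shows "Dist X = {\<phi> \<in> X \<rightarrow>\<^sub>E {0..1}. (\<Sum>x\<in>X. \<phi> x) = 1}"
proof -
  have "(\<Sum>x\<in>{x \<in> X. \<phi> x \<noteq> 0}. \<phi> x) = (\<Sum>x\<in>X. \<phi> x)" for \<phi> :: "'a \<Rightarrow> real"
    using assms by (intro sum.mono_neutral_left) auto
  then show ?thesis using assms by (simp add: Dist_def)
qed

lemma Dist_lessThan_iff:
  fixes m :: nat
  shows "\<phi> \<in> Dist {..<m} \<longleftrightarrow> \<phi> \<in> extensional {..<m} \<and> (\<forall>j<m. 0 \<le> \<phi> j) \<and> (\<Sum>j<m. \<phi> j) = 1"
proof -
  have "\<phi> j \<le> 1" if "\<forall>j<m. 0 \<le> \<phi> j" "(\<Sum>j<m. \<phi> j) = 1" "j < m" for j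
    using member_le_sum[of j "{..<m}" \<phi>] that by auto
  then show ?thesis by (auto simp: Dist_finite PiE_def Pi_iff)
qed

text \<open>
  The monad multiplication sums over distributions \<open>\<psi>\<close>, and the weight of \<open>\<psi>\<close> is the total
  weight of its fibre under \<open>g\<close>. Only distributions in the image of \<open>g\<close> contribute, so the two sums
  merge into one over \<open>X\<close>.
\<close>

lemma Dist_mult_Dist_map:
  assumes "finite X" and g: "g \<in> X \<rightarrow> Dist Y"
  shows "Dist_mult Y (Dist_map X (Dist Y) g \<phi>) = (\<lambda>y\<in>Y. \<Sum>x\<in>X. \<phi> x * g x y)"
proof -
  define \<Phi> where "\<Phi> \<psi> = (\<Sum>x\<in>{x \<in> X. g x = \<psi>}. \<phi> x)" for \<psi>
  have map: "Dist_map X (Dist Y) g \<phi> \<psi> = \<Phi> \<psi>" if "\<psi> \<in> Dist Y" for \<psi>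
    using that assms(1) unfolding Dist_map_def \<Phi>_def
    by (auto intro!: sum.mono_neutral_left)
  have out: "\<Phi> \<psi> = 0" if "\<psi> \<notin> g ` X" for \<psi>
    using that unfolding \<Phi>_def by (intro sum.neutral) auto
  have "(\<Sum>\<psi>\<in>{\<psi> \<in> Dist Y. Dist_map X (Dist Y) g \<phi> \<psi> \<noteq> 0}. Dist_map X (Dist Y) g \<phi> \<psi> * \<psi> y)
      = (\<Sum>x\<in>X. \<phi> x * g x y)" for y
  proof -
    have "(\<Sum>\<psi>\<in>{\<psi> \<in> Dist Y. Dist_map X (Dist Y) g \<phi> \<psi> \<noteq> 0}. Dist_map X (Dist Y) g \<phi> \<psi> * \<psi> y)
        = (\<Sum>\<psi>\<in>{\<psi> \<in> Dist Y. \<Phi> \<psi> \<noteq> 0}. \<Phi> \<psi> * \<psi> y)"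
      by (intro sum.cong) (auto simp: map)
    also have "\<dots> = (\<Sum>\<psi>\<in>g ` X. \<Phi> \<psi> * \<psi> y)"
      using assms out by (intro sum.mono_neutral_left) auto
    also have "\<dots> = (\<Sum>\<psi>\<in>g ` X. \<Sum>x\<in>{x \<in> X. g x = \<psi>}. \<phi> x * g x y)"
      unfolding \<Phi>_def sum_distrib_right by (intro sum.cong) auto
    also have "\<dots> = (\<Sum>x\<in>X. \<phi> x * g x y)"
      using assms(1) by (rule sum.image_gen[symmetric])
    finally show ?thesis .
  qed
  then show ?thesis by (simp add: Dist_mult_def)
qed

lemma Ob_KlN: "Ob KlN = UNIV"
  by (simp add: KlN_def)

lemma Hom_KlN_iff:
  "f \<in> Hom KlN n m \<longleftrightarrow> f \<in> extensional {..<n} \<and>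
    (\<forall>i<n. f i \<in> extensional {..<m} \<and> (\<forall>j<m. 0 \<le> f i j) \<and> (\<Sum>j<m. f i j) = 1)"
  by (auto simp: KlN_def PiE_def Pi_iff Dist_lessThan_iff)

lemma Hom_KlN_eqI:
  assumes "f \<in> Hom KlN n m" "g \<in> Hom KlN n m" "\<And>i j. \<lbrakk>i < n; j < m\<rbrakk> \<Longrightarrow> f i j = g i j"
  shows "f = g"
proof (rule extensionalityI)
  show "f \<in> extensional {..<n}" "g \<in> extensional {..<n}"
    using assms by (auto simp: Hom_KlN_iff)
  show "f i = g i" if "i \<in> {..<n}" for i
    using assms that by (intro extensionalityI[of "f i" "{..<m}"]) (auto simp: Hom_KlN_iff)
qed

lemma Ident_KlN: "Ident KlN n = (\<lambda>i\<in>{..<n}. \<lambda>j\<in>{..<n}. if j = i then 1 else 0)"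
  by (simp add: KlN_def Dist_unit_def)

lemma Comp_KlN:
  assumes "g \<in> Hom KlN m k"
  shows "Comp KlN n m k g f = (\<lambda>i\<in>{..<n}. \<lambda>l\<in>{..<k}. \<Sum>j<m. f i j * g j l)"
  using assms by (auto simp: KlN_def Dist_mult_Dist_map PiE_def cong: restrict_cong)

lemma Ident_KlN_in_Hom: "Ident KlN n \<in> Hom KlN n n"
  by (simp add: Hom_KlN_iff Ident_KlN)

lemma Comp_KlN_in_Hom:
  assumes f: "f \<in> Hom KlN n m" and g: "g \<in> Hom KlN m k"
  shows "Comp KlN n m k g f \<in> Hom KlN n k"
proof -
  have "(\<Sum>l<k. \<Sum>j<m. f i j * g j l) = 1" if "i < n" for i
  proof -
    have "(\<Sum>l<k. \<Sum>j<m. f i j * g j l) = (\<Sum>j<m. f i j * (\<Sum>l<k. g j l))"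
      by (subst sum.swap) (simp add: sum_distrib_left)
    also have "\<dots> = (\<Sum>j<m. f i j)"
      using g by (intro sum.cong) (auto simp: Hom_KlN_iff)
    finally show ?thesis using f that by (simp add: Hom_KlN_iff)
  qed
  then show ?thesis
    using f g by (auto simp: Comp_KlN[OF g] Hom_KlN_iff intro!: sum_nonneg)
qed

lemma category_KlN: "category KlN"
proof
  show "Comp KlN n n m f (Ident KlN n) = f" if f: "f \<in> Hom KlN n m" for n m f
    by (rule Hom_KlN_eqI[OF Comp_KlN_in_Hom[OF Ident_KlN_in_Hom f] f])
      (simp add: Comp_KlN[OF f] Ident_KlN if_distrib[of "\<lambda>x. x * _"] cong: if_cong)
  show "Comp KlN n m m (Ident KlN m) f = f" if f: "f \<in> Hom KlN n m" for n m f
    by (rule Hom_KlN_eqI[OF Comp_KlN_in_Hom[OF f Ident_KlN_in_Hom] f])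
      (unfold Comp_KlN[OF Ident_KlN_in_Hom],
        simp add: Ident_KlN if_distrib[of "\<lambda>x. _ * x"] cong: if_cong)
  show "Comp KlN n m l (Comp KlN m k l h g) f = Comp KlN n k l h (Comp KlN n m k g f)"
    if f: "f \<in> Hom KlN n m" and g: "g \<in> Hom KlN m k" and h: "h \<in> Hom KlN k l" for n m k l f g h
  proof (rule Hom_KlN_eqI)
    note gf = Comp_KlN_in_Hom[OF f g] and hg = Comp_KlN_in_Hom[OF g h]
    show "Comp KlN n m l (Comp KlN m k l h g) f \<in> Hom KlN n l" by (rule Comp_KlN_in_Hom[OF f hg])
    show "Comp KlN n k l h (Comp KlN n m k g f) \<in> Hom KlN n l" by (rule Comp_KlN_in_Hom[OF gf h])
    fix i j assume ij: "i < n" "j < l"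
    have "(\<Sum>q<m. f i q * (\<Sum>r<k. g q r * h r j)) = (\<Sum>r<k. (\<Sum>q<m. f i q * g q r) * h r j)"
      unfolding sum_distrib_left sum_distrib_right mult.assoc by (rule sum.swap)
    then show "Comp KlN n m l (Comp KlN m k l h g) f i j = Comp KlN n k l h (Comp KlN n m k g f) i j"
      using ij by (subst Comp_KlN[OF hg]) (simp add: Comp_KlN[OF h] Comp_KlN[OF g])
  qed
qed (simp_all add: Ident_KlN_in_Hom Comp_KlN_in_Hom)

section \<open>Stochastic matrices are the positive unital maps between the algebras \<open>\<complex>\<^sup>n\<close>\<close>

text \<open>
  Coordinatewise, \<open>y\<^sup>* y\<close> is \<open>\<bar>y i\<bar>\<^sup>2\<close>, and conversely nonnegative reals have square roots.
\<close>

lemma cstar_positive_Cn_iff: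
  assumes "v \<in> carrier (Cn n)"
  shows "cstar_positive (Cn n) v \<longleftrightarrow> (\<forall>i<n. \<exists>r\<ge>0. v i = complex_of_real r)"
proof
  assume "cstar_positive (Cn n) v"
  then obtain y where "v = star (Cn n) y \<otimes>\<^bsub>Cn n\<^esub> y" by (auto simp: cstar_positive_def)
  then have "v i = complex_of_real ((cmod (y i))\<^sup>2)" if "i < n" for i
    using that complex_norm_square[of "y i"] by (simp add: mult.commute)
  then show "\<forall>i<n. \<exists>r\<ge>0. v i = complex_of_real r" by (meson zero_le_power2)
next
  assume "\<forall>i<n. \<exists>r\<ge>0. v i = complex_of_real r"
  then obtain r where r: "\<And>i. i < n \<Longrightarrow> r i \<ge> 0" "\<And>i. i < n \<Longrightarrow> v i = complex_of_real (r i)"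
    by metis
  define y where "y = (\<lambda>i\<in>{..<n}. complex_of_real (sqrt (r i)))"
  have "v = star (Cn n) y \<otimes>\<^bsub>Cn n\<^esub> y"
    using assms r by (subst Cn_eq_iff[of _ n]) (auto simp: y_def simp flip: of_real_mult)
  moreover have "y \<in> carrier (Cn n)" by (simp add: y_def)
  ultimately show "cstar_positive (Cn n) v" unfolding cstar_positive_def by blast
qed

lemma delta_vec_positive: "cstar_positive (Cn n) (delta_vec n j)"
proof (subst cstar_positive_Cn_iff)
  show "\<forall>i<n. \<exists>r\<ge>0. delta_vec n j i = complex_of_real r"
    by (auto intro: exI[of _ 0] exI[of _ 1])
qed simp

lemma pu_map_finsum:
  assumes A: "comm_cstar_algebra A" and B: "comm_cstar_algebra B" and f: "pu_map A B f"
    and g: "\<And>s. s \<in> S \<Longrightarrow> g s \<in> carrier A" and "finite S"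
  shows "f (finsum A g S) = finsum B (\<lambda>s. f (g s)) S"
proof -
  interpret A: comm_cstar_algebra A by fact
  interpret B: comm_cstar_algebra B by fact
  have "f \<zero>\<^bsub>A\<^esub> = f (0 \<odot>\<^bsub>A\<^esub> \<zero>\<^bsub>A\<^esub>)" by (simp add: A.smult_0_left)
  also have "\<dots> = \<zero>\<^bsub>B\<^esub>" by (subst pu_map_smult[OF f]) (simp_all add: pu_map_closed[OF f] B.smult_0_left)
  finally have zero: "f \<zero>\<^bsub>A\<^esub> = \<zero>\<^bsub>B\<^esub>" .
  show ?thesis
    using \<open>finite S\<close> g
    by (induction S rule: finite_induct)
      (simp_all add: zero Pi_iff pu_map_closed[OF f] pu_map_add[OF f])
qed

lemma pu_map_Cn_expand:
  assumes h: "pu_map (Cn m) (Cn n) h" and v: "v \<in> carrier (Cn m)" and i: "i < n"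
  shows "h v i = (\<Sum>j<m. h (delta_vec m j) i * v j)"
proof -
  have \<delta>: "delta_vec m j \<in> carrier (Cn m)" for j by simp
  have c: "v j \<odot>\<^bsub>Cn m\<^esub> delta_vec m j \<in> carrier (Cn m)" for j by simp
  have "h v = h (finsum (Cn m) (\<lambda>j. v j \<odot>\<^bsub>Cn m\<^esub> delta_vec m j) {..<m})"
    using Cn_sum_delta_vec[OF v] by simp
  also have "\<dots> = finsum (Cn n) (\<lambda>j. h (v j \<odot>\<^bsub>Cn m\<^esub> delta_vec m j)) {..<m}"
    by (rule pu_map_finsum[OF Cn_comm_cstar_algebra Cn_comm_cstar_algebra h c]) simp
  also have "\<dots> = (\<lambda>i\<in>{..<n}. \<Sum>j<m. h (v j \<odot>\<^bsub>Cn m\<^esub> delta_vec m j) i)"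
    by (rule finsum_Cn) (rule pu_map_closed[OF h c])
  finally have "h v i = (\<Sum>j<m. h (v j \<odot>\<^bsub>Cn m\<^esub> delta_vec m j) i)"
    using i by simp
  also have "\<dots> = (\<Sum>j<m. h (delta_vec m j) i * v j)"
    unfolding pu_map_smult[OF h \<delta>] using i by (simp add: mult.commute)
  finally show ?thesis .
qed

lemma CD_map_apply:
  "\<lbrakk>v \<in> carrier (Cn m); i < n\<rbrakk> \<Longrightarrow> CD_map n m f v i = (\<Sum>j<m. complex_of_real (f i j) * v j)"
  by (simp add: CD_map_def)

lemma CD_map_closed: "v \<in> carrier (Cn m) \<Longrightarrow> CD_map n m f v \<in> carrier (Cn n)"
  by (simp add: CD_map_def)

lemma CD_map_delta_vec:
  assumes "i < n" "j < m"
  shows "CD_map n m f (delta_vec m j) i = complex_of_real (f i j)"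
proof -
  have "CD_map n m f (delta_vec m j) i = (\<Sum>l<m. if l = j then complex_of_real (f i l) else 0)"
  proof -
    have "CD_map n m f (delta_vec m j) i
        = (\<Sum>l<m. complex_of_real (f i l) * delta_vec m j l)"
      by (rule CD_map_apply[OF _ assms(1)]) simp
    also have "\<dots> = (\<Sum>l<m. if l = j then complex_of_real (f i l) else 0)"
      by (rule sum.cong) auto
    finally show ?thesis .
  qed
  then show ?thesis using assms(2) by simp
qed

lemma pu_map_CD_map:
  assumes f: "f \<in> Hom KlN n m"
  shows "pu_map (Cn m) (Cn n) (CD_map n m f)"
proof (rule pu_mapI)
  fix v w c assume v: "v \<in> carrier (Cn m)"
  show "CD_map n m f v \<in> carrier (Cn n)" by (rule CD_map_closed[OF v])
  show "CD_map n m f (c \<odot>\<^bsub>Cn m\<^esub> v) = c \<odot>\<^bsub>Cn n\<^esub> CD_map n m f v"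
    using v by (simp add: CD_map_def sum_distrib_left mult.left_commute cong: restrict_cong)
  show "cstar_positive (Cn n) (CD_map n m f v)" if pos: "cstar_positive (Cn m) v"
  proof (subst cstar_positive_Cn_iff[OF CD_map_closed[OF v]], intro allI impI)
    fix i assume i: "i < n"
    obtain r where r: "\<And>j. j < m \<Longrightarrow> r j \<ge> 0 \<and> v j = complex_of_real (r j)"
      using pos[unfolded cstar_positive_Cn_iff[OF v]] by metis
    have "CD_map n m f v i = complex_of_real (\<Sum>j<m. f i j * r j)"
      unfolding CD_map_apply[OF v i] of_real_sum of_real_mult using r by simp
    moreover have "(\<Sum>j<m. f i j * r j) \<ge> 0"
      using f i r by (intro sum_nonneg mult_nonneg_nonneg) (auto simp: Hom_KlN_iff)
    ultimately show "\<exists>r\<ge>0. CD_map n m f v i = complex_of_real r" by blast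
  qed
  assume w: "w \<in> carrier (Cn m)"
  show "CD_map n m f (v \<oplus>\<^bsub>Cn m\<^esub> w) = CD_map n m f v \<oplus>\<^bsub>Cn n\<^esub> CD_map n m f w"
    using v w by (simp add: CD_map_def distrib_left sum.distrib cong: restrict_cong)
next
  have "(\<Sum>j<m. complex_of_real (f i j)) = 1" if "i < n" for i
    using f that unfolding Hom_KlN_iff of_real_sum[symmetric] by simp
  then show "CD_map n m f \<one>\<^bsub>Cn m\<^esub> = \<one>\<^bsub>Cn n\<^esub>"
    by (simp add: CD_map_def cong: restrict_cong)
qed

text \<open>
  The basis vectors are positive, so the matrix entries of a positive map are nonnegative reals;
  its rows sum to \<open>1\<close> because the vectors add up to the unit. There is no map from the zero algebra
  to a nonzero one, just as there is no distribution on the empty set.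
\<close>

lemma bij_betw_CD_map:
  "bij_betw (CD_map n m) (Hom KlN n m) {h \<in> extensional (carrier (Cn m)). pu_map (Cn m) (Cn n) h}"
  unfolding bij_betw_def
proof
  show "inj_on (CD_map n m) (Hom KlN n m)"
  proof (rule inj_onI)
    fix f g assume f: "f \<in> Hom KlN n m" and g: "g \<in> Hom KlN n m" and eq: "CD_map n m f = CD_map n m g"
    show "f = g"
    proof (rule Hom_KlN_eqI[OF f g])
      fix i j assume "i < n" "j < m"
      then show "f i j = g i j"
        using CD_map_delta_vec[of i n j m f] CD_map_delta_vec[of i n j m g] eq by simp
    qed
  qed
  have "h \<in> CD_map n m ` Hom KlN n m"
    if ext: "h \<in> extensional (carrier (Cn m))" and h: "pu_map (Cn m) (Cn n) h" for h
  proof -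
    have \<delta>: "delta_vec m j \<in> carrier (Cn m)" for j by simp
    have "\<exists>r\<ge>0. h (delta_vec m j) i = complex_of_real r" if "i < n" for i j
      using pu_map_positive[OF h \<delta> delta_vec_positive] that
      by (subst (asm) cstar_positive_Cn_iff[OF pu_map_closed[OF h \<delta>]]) auto
    then obtain r where r: "\<And>i j. i < n \<Longrightarrow> r i j \<ge> 0 \<and> h (delta_vec m j) i = complex_of_real (r i j)"
      by metis
    define f where "f = (\<lambda>i\<in>{..<n}. \<lambda>j\<in>{..<m}. r i j)"
    have one: "\<one>\<^bsub>Cn m\<^esub> \<in> carrier (Cn m)" by simp
    have "(\<Sum>j<m. r i j) = 1" if i: "i < n" for i
    proof -
      have "complex_of_real (\<Sum>j<m. r i j) = (\<Sum>j<m. h (delta_vec m j) i * \<one>\<^bsub>Cn m\<^esub> j)"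
        unfolding of_real_sum using r i by simp
      also have "\<dots> = h \<one>\<^bsub>Cn m\<^esub> i" by (rule pu_map_Cn_expand[OF h one i, symmetric])
      also have "\<dots> = 1" using i by (simp only: pu_map_one[OF h]) simp
      finally show ?thesis by (simp only: of_real_eq_1_iff)
    qed
    then have "f \<in> Hom KlN n m" using r by (auto simp: Hom_KlN_iff f_def)
    moreover have "h = CD_map n m f"
    proof (rule extensionalityI[OF ext])
      show "CD_map n m f \<in> extensional (carrier (Cn m))" by (simp add: CD_map_def)
      fix v assume v: "v \<in> carrier (Cn m)"
      show "h v = CD_map n m f v"
        using pu_map_Cn_expand[OF h v] r
        by (subst Cn_eq_iff[OF pu_map_closed[OF h v] CD_map_closed[OF v]])
          (simp add: CD_map_apply[OF v] f_def)
    qed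
    ultimately show ?thesis by blast
  qed
  then show "CD_map n m ` Hom KlN n m = {h \<in> extensional (carrier (Cn m)). pu_map (Cn m) (Cn n) h}"
    by (auto simp: pu_map_CD_map) (simp add: CD_map_def)
qed

lemma CD_map_ident: "CD_map n n (Ident KlN n) = (\<lambda>v\<in>carrier (Cn n). v)"
proof (rule extensionalityI)
  fix v assume v: "v \<in> carrier (Cn n)"
  have "CD_map n n (Ident KlN n) v i = v i" if i: "i < n" for i
  proof -
    have "CD_map n n (Ident KlN n) v i = (\<Sum>j<n. if j = i then v j else 0)"
      unfolding CD_map_apply[OF v i] by (intro sum.cong) (use i in \<open>auto simp: Ident_KlN\<close>)
    then show ?thesis using i by simp
  qed
  then show "CD_map n n (Ident KlN n) v = (\<lambda>v\<in>carrier (Cn n). v) v"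
    using Cn_eq_iff[OF CD_map_closed[OF v] v] v by simp
qed (simp_all add: CD_map_def)

lemma CD_map_comp:
  assumes f: "f \<in> Hom KlN n m" and g: "g \<in> Hom KlN m k"
  shows "CD_map n k (Comp KlN n m k g f) = compose (carrier (Cn k)) (CD_map n m f) (CD_map m k g)"
proof (rule extensionalityI)
  fix v assume v: "v \<in> carrier (Cn k)"
  note gv = CD_map_closed[OF v, of m g]
  have "CD_map n k (Comp KlN n m k g f) v i = CD_map n m f (CD_map m k g v) i" if i: "i < n" for i
  proof -
    have "(\<Sum>l<k. complex_of_real (\<Sum>j<m. f i j * g j l) * v l)
        = (\<Sum>j<m. complex_of_real (f i j) * (\<Sum>l<k. complex_of_real (g j l) * v l))"
      unfolding of_real_sum of_real_mult sum_distrib_left sum_distrib_right mult.assoc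
      by (rule sum.swap)
    then show ?thesis
      using i by (simp add: CD_map_apply[OF v] CD_map_apply[OF gv] Comp_KlN[OF g] del: Cn_simps)
  qed
  then show "CD_map n k (Comp KlN n m k g f) v = compose (carrier (Cn k)) (CD_map n m f) (CD_map m k g) v"
    using Cn_eq_iff[OF CD_map_closed[OF v] CD_map_closed[OF gv]] v by (simp add: compose_eq del: Cn_simps)
qed (simp_all add: CD_map_def compose_def)

section \<open>Positive unital maps between transported algebras\<close>

lemma transport_map_apply:
  "\<lbrakk>inj \<iota>; x \<in> carrier A\<rbrakk> \<Longrightarrow> transport_map \<iota> A h (\<iota> x) = \<iota> (h x)"
  by (simp add: transport_map_def)

text \<open>
  An algebra and its transport are isomorphic as star-algebras, so conjugation with these
  isomorphisms identifies the two sets of positive unital maps.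
\<close>

lemma bij_betw_transport_map:
  assumes \<iota>: "inj \<iota>" and A: "comm_cstar_algebra A" and B: "comm_cstar_algebra B"
  shows "bij_betw (transport_map \<iota> A) {h \<in> extensional (carrier A). pu_map A B h}
    (Hom FdCCstar_PU (transport \<iota> A) (transport \<iota> B))"
  unfolding bij_betw_def
proof
  interpret A: comm_cstar_algebra A by fact
  interpret B: comm_cstar_algebra B by fact
  interpret TA: comm_cstar_algebra "transport \<iota> A" by (rule A.transport_comm_cstar_algebra[OF \<iota>])
  interpret TB: comm_cstar_algebra "transport \<iota> B" by (rule B.transport_comm_cstar_algebra[OF \<iota>])
  have bij: "bij_betw \<iota> (carrier C) (carrier (transport \<iota> C))" for C
    using inj_on_subset[OF \<iota>] by (simp add: bij_betw_def)
  note in_A = A.star_hom_pu_map[OF star_hom_transport[OF \<iota>]]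
    and in_B = B.star_hom_pu_map[OF star_hom_transport[OF \<iota>]]
    and out_A = TA.star_hom_pu_map[OF A.star_hom_inv_into[OF star_hom_transport[OF \<iota>] bij]]
    and out_B = TB.star_hom_pu_map[OF B.star_hom_inv_into[OF star_hom_transport[OF \<iota>] bij]]
  have inv_A: "inv_into (carrier A) \<iota> (\<iota> x) = x" if "x \<in> carrier A" for x
    using that inj_on_subset[OF \<iota>] by (intro inv_into_f_f) auto
  have inv_B: "\<iota> (inv_into (carrier B) \<iota> y) = y" if "y \<in> \<iota> ` carrier B" for y
    using that by (rule f_inv_into_f)
  show "inj_on (transport_map \<iota> A) {h \<in> extensional (carrier A). pu_map A B h}"
  proof (rule inj_onI)
    fix h k
    assume h: "h \<in> {h \<in> extensional (carrier A). pu_map A B h}"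
      and k: "k \<in> {h \<in> extensional (carrier A). pu_map A B h}"
      and eq: "transport_map \<iota> A h = transport_map \<iota> A k"
    show "h = k"
    proof (rule extensionalityI[of _ "carrier A"])
      fix x assume "x \<in> carrier A"
      then have "\<iota> (h x) = \<iota> (k x)"
        using transport_map_apply[OF \<iota>, of x A h] transport_map_apply[OF \<iota>, of x A k] eq by simp
      then show "h x = k x" using \<iota> by (simp add: inj_eq)
    qed (use h k in auto)
  qed
  show "transport_map \<iota> A ` {h \<in> extensional (carrier A). pu_map A B h}
      = Hom FdCCstar_PU (transport \<iota> A) (transport \<iota> B)"
  proof (intro equalityI subsetI)
    fix t assume "t \<in> transport_map \<iota> A ` {h \<in> extensional (carrier A). pu_map A B h}"
    then obtain h where t: "t = transport_map \<iota> A h" and h: "pu_map A B h" by auto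
    have "pu_map (transport \<iota> A) (transport \<iota> B) t"
      by (rule TA.pu_map_cong[OF pu_map_comp[OF pu_map_comp[OF out_A h] in_B]])
        (auto simp: t transport_map_apply[OF \<iota>] inv_A)
    then show "t \<in> Hom FdCCstar_PU (transport \<iota> A) (transport \<iota> B)"
      by (simp add: FdCCstar_PU_def t) (simp add: transport_map_def)
  next
    fix t assume "t \<in> Hom FdCCstar_PU (transport \<iota> A) (transport \<iota> B)"
    then have ext: "t \<in> extensional (\<iota> ` carrier A)" and t: "pu_map (transport \<iota> A) (transport \<iota> B) t"
      by (simp_all add: FdCCstar_PU_def)
    define h where "h = (\<lambda>x\<in>carrier A. inv_into (carrier B) \<iota> (t (\<iota> x)))"
    have "pu_map A B h"
      by (rule A.pu_map_cong[OF pu_map_comp[OF pu_map_comp[OF in_A t] out_B]]) (simp add: h_def)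
    moreover have "h \<in> extensional (carrier A)" by (simp add: h_def)
    moreover have "t = transport_map \<iota> A h"
    proof (rule extensionalityI[OF ext])
      show "transport_map \<iota> A h \<in> extensional (\<iota> ` carrier A)" by (simp add: transport_map_def)
      fix y assume "y \<in> \<iota> ` carrier A"
      then obtain x where x: "x \<in> carrier A" "y = \<iota> x" by blast
      have "t y \<in> \<iota> ` carrier B" using pu_map_closed[OF t, of y] x by simp
      then show "t y = transport_map \<iota> A h y"
        using x inv_B by (simp add: transport_map_apply[OF \<iota>] h_def)
    qed
    ultimately show "t \<in> transport_map \<iota> A ` {h \<in> extensional (carrier A). pu_map A B h}" by blast
  qed
qed

lemma transport_map_ident:
  "inj \<iota> \<Longrightarrow> transport_map \<iota> A (\<lambda>x\<in>carrier A. x) = (\<lambda>y\<in>\<iota> ` carrier A. y)"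
  by (auto simp: transport_map_def fun_eq_iff restrict_def)

lemma transport_map_compose:
  assumes \<iota>: "inj \<iota>" and h: "\<And>x. x \<in> carrier A \<Longrightarrow> h x \<in> carrier B"
  shows "transport_map \<iota> A (compose (carrier A) k h)
    = compose (\<iota> ` carrier A) (transport_map \<iota> B k) (transport_map \<iota> A h)"
  using assms by (auto simp: transport_map_def compose_def fun_eq_iff restrict_def inj_eq)

section \<open>The equivalence\<close>

lemma ex_iso_transport_Cn:
  fixes A :: "'u cstar" and \<iota> :: "(nat \<Rightarrow> complex) \<Rightarrow> 'u"
  assumes \<iota>: "inj \<iota>" and A: "A \<in> Ob FdCCstar_PU"
  shows "\<exists>n f. is_iso FdCCstar_PU A (transport \<iota> (Cn n)) f"
proof -
  interpret fin_dim_comm_cstar_algebra A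
    using A
    by (simp add: FdCCstar_PU_def fin_dim_comm_cstar_algebra_def fin_dim_comm_cstar_algebra_axioms_def)
  obtain n \<psi> where \<psi>: "star_hom (Cn n) A \<psi>" and bij: "bij_betw \<psi> (carrier (Cn n)) (carrier A)"
    using ex_star_iso_Cn by blast
  interpret C: comm_cstar_algebra "Cn n" by (rule Cn_comm_cstar_algebra)
  let ?\<phi> = "inv_into (carrier (Cn n)) \<psi>"
  have T: "comm_cstar_algebra (transport \<iota> (Cn n))" by (rule C.transport_comm_cstar_algebra[OF \<iota>])
  have "star_hom A (transport \<iota> (Cn n)) (\<lambda>x. \<iota> (?\<phi> x))"
    using C.star_hom_inv_into[OF \<psi> bij] star_hom_transport[OF \<iota>, of "Cn n"]
    unfolding star_hom_def by (simp add: Pi_iff \<iota>)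
  moreover have "bij_betw (\<lambda>x. \<iota> (?\<phi> x)) (carrier A) (carrier (transport \<iota> (Cn n)))"
    using bij_betw_trans[OF bij_betw_inv_into[OF bij], of \<iota> "carrier (transport \<iota> (Cn n))"]
      inj_on_subset[OF \<iota>] by (simp add: bij_betw_def comp_def)
  ultimately show ?thesis
    using is_iso_FdCCstar_PU_if_star_iso[OF comm_cstar_algebra_axioms T] by blast
qed

theorem proposition4p3:
  fixes \<iota> :: "(nat \<Rightarrow> complex) \<Rightarrow> 'u"
  assumes "inj \<iota>"
  shows "is_equivalence KlN (op_cat (FdCCstar_PU :: ('u cstar, 'u \<Rightarrow> 'u) cat))
           (\<lambda>n. transport \<iota> (Cn n))
           (\<lambda>n m f. transport_map \<iota> (Cn m) (CD_map n m f))"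
proof -
  let ?D = "op_cat (FdCCstar_PU :: ('u cstar, 'u \<Rightarrow> 'u) cat)"
  let ?Fo = "\<lambda>n. transport \<iota> (Cn n)"
  let ?Fm = "\<lambda>n m f. transport_map \<iota> (Cn m) (CD_map n m f)"
  have bij: "bij_betw (?Fm n m) (Hom KlN n m) (Hom ?D (?Fo n) (?Fo m))" for n m
    using bij_betw_trans[OF bij_betw_CD_map[of n m]
        bij_betw_transport_map[OF assms Cn_comm_cstar_algebra Cn_comm_cstar_algebra, of m n]]
    by (simp add: op_cat_def comp_def)
  interpret fully_faithful_functor KlN ?D ?Fo ?Fm
  proof (intro fully_faithful_functor.intro fully_faithful_functor_axioms.intro cat_functor.intro
      cat_functor_axioms.intro category_KlN category_op_cat category_FdCCstar_PU)
    show "bij_betw (?Fm n m) (Hom KlN n m) (Hom ?D (?Fo n) (?Fo m))" for n m by (rule bij)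
    show "?Fm n m f \<in> Hom ?D (?Fo n) (?Fo m)" if "f \<in> Hom KlN n m" for n m f
      using bij_betwE[OF bij[where n = n and m = m]] that by blast
    show "?Fo n \<in> Ob ?D" for n
      using transport_Cn_in_Ob[OF assms] by (simp add: Ob_op_cat)
    show "?Fm n n (Ident KlN n) = Ident ?D (?Fo n)" for n
      unfolding CD_map_ident transport_map_ident[OF assms] by (simp add: op_cat_def FdCCstar_PU_def)
    show "?Fm n k (Comp KlN n m k g f) = Comp ?D (?Fo n) (?Fo m) (?Fo k) (?Fm m k g) (?Fm n m f)"
      if "f \<in> Hom KlN n m" "g \<in> Hom KlN m k" for n m k f g
    proof -
      have "?Fm n k (Comp KlN n m k g f)
          = compose (\<iota> ` carrier (Cn k)) (transport_map \<iota> (Cn m) (CD_map n m f)) (?Fm m k g)"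
        unfolding CD_map_comp[OF that] by (rule transport_map_compose[OF assms CD_map_closed])
      then show ?thesis by (simp add: op_cat_def FdCCstar_PU_def)
    qed
  qed
  show ?thesis
  proof (rule is_equivalence_if_essentially_surjective)
    fix A :: "'u cstar" assume "A \<in> Ob ?D"
    then show "\<exists>n\<in>Ob KlN. \<exists>f. is_iso ?D (?Fo n) A f"
      using ex_iso_transport_Cn[OF assms, of A] by (simp add: is_iso_op_cat Ob_KlN Ob_op_cat)
  qed
qed

end
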